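(* Let $V$ be an irreducible uniformly bounded weight module for $(\mathcal{S}_N\ltimes A_N)\otimes B$ on which $t^{\mathbf{0}}$ acts non-trivially and $t^{\mathbf{s}}$ acts non-trivially for some $\mathbf{s}\neq\mathbf{0}$. Let $\lambda$ be a weight of $V$, $\Lambda=(\lambda(d_i))_{i=1}^N$ and $V_\Lambda=\{v\in V\mid d_iv=\lambda(d_i)v\ \forall i\}$. Then the elements $D(u,\mathbf{0})b$, $u\in\mathbb{C}^N$, $b\in B$, act as scalars on $V_\Lambda$.
   Context: All vector spaces, algebras and tensor products are over $\mathbb{C}$; $B$ is a finitely generated commutative associative unital algebra; $N\ge 2$ is an integer. $A_N=\mathbb{C}[t_1^{\pm1},\dots,t_N^{\pm1}]$, $t^{\mathbf{m}}=t_1^{m_1}\cdots t_N^{m_N}$, $d_i=t_i\frac{d}{dt_i}$, $(x,y)=\sum_ix_iy_i$. For $u\in\mathbb{C}^N$, $\mathbf{r}\in\mathbb{Z}^N$ put $D(u,\mathbf{r})=\sum_iu_it^{\mathbf{r}}d_i$; $\mathcal{S}_N=\mathrm{span}\{D(u,\mathbf{r})\mid(u,\mathbf{r})=0\}$ with $[D(u,\mathbf{r}),D(v,\mathbf{s})]=D((u,\mathbf{s})v-(v,\mathbf{r})u,\mathbf{r}+\mathbf{s})$. In $\mathcal{S}_N\ltimes A_N$, $A_N$ is an abelian ideal and $[D(u,\mathbf{r}),t^{\mathbf{s}}]=(u,\mathbf{s})t^{\mathbf{r}+\mathbf{s}}$. For a Lie algebra $\mathfrak{g}$, $\mathfrak{g}\otimes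 B$ has bracket $[x\otimes b_1,y\otimes b_2]=[x,y]\otimes b_1b_2$; write $xb=x\otimes b$ and $x=x\otimes1$. $\mathfrak{h}=\mathrm{span}\{d_1,\dots,d_N\}$. A uniformly bounded weight module is a module $V=\bigoplus_{\lambda\in\mathfrak{h}^*}V_\lambda$, $V_\lambda=\{v\mid hv=\lambda(h)v\ \forall h\in\mathfrak{h}\}$, for which there is a positive integer $M$ with $\dim V_\lambda\le M$ for all $\lambda$. *)

theory Defs
  imports "HOL-Analysis.Analysis" "HOL-Library.Poly_Mapping" "HOL-Library.Function_Algebras"
begin

section \<open>Complex vector spaces\<close>

class complex_vector = ab_group_add +
  fixes scaleC :: "complex \<Rightarrow> 'a \<Rightarrow> 'a"  (infixr \<open>*\<^sub>C\<close> 75)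
  assumes scaleC_add_right: "a *\<^sub>C (x + y) = a *\<^sub>C x + a *\<^sub>C y"
    and scaleC_add_left: "(a + b) *\<^sub>C x = a *\<^sub>C x + b *\<^sub>C x"
    and scaleC_scaleC: "a *\<^sub>C b *\<^sub>C x = (a * b) *\<^sub>C x"
    and scaleC_one: "1 *\<^sub>C x = x"

global_interpretation complex_vector: vector_space "scaleC :: complex \<Rightarrow> 'a \<Rightarrow> 'a::complex_vector"
  by unfold_locales (simp_all add: scaleC_add_right scaleC_add_left scaleC_scaleC scaleC_one)

abbreviation clinear :: "('a::complex_vector \<Rightarrow> 'b::complex_vector) \<Rightarrow> bool" where
  "clinear \<equiv> Vector_Spaces.linear (*\<^sub>C) (*\<^sub>C)"

definition cbilinear :: "('a::complex_vector \<Rightarrow> 'b::complex_vector \<Rightarrow> 'c::complex_vector) \<Rightarrow> bool" where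
  "cbilinear h \<longleftrightarrow> (\<forall>x. clinear (h x)) \<and> (\<forall>y. clinear (\<lambda>x. h x y))"

lemma clinearI:
  assumes "\<And>x y. f (x + y) = f x + f y" "\<And>c x. f (c *\<^sub>C x) = c *\<^sub>C f x"
  shows "clinear f"
  by unfold_locales (simp_all add: assms)

lemma clinear_add: "clinear f \<Longrightarrow> f (x + y) = f x + f y"
  by (simp add: Vector_Spaces.linear_iff)

lemma clinear_scale: "clinear f \<Longrightarrow> f (c *\<^sub>C x) = c *\<^sub>C f x"
  by (simp add: Vector_Spaces.linear_iff)

lemma clinear_0: "clinear f \<Longrightarrow> f 0 = 0"
  using clinear_add[of f 0 0] by simp

lemma clinear_minus: "clinear f \<Longrightarrow> f (- x) = - f x"
  using clinear_add[of f x "- x"] clinear_0[of f] by (simp add: eq_neg_iff_add_eq_0 add.commute)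

lemma clinear_diff: "clinear f \<Longrightarrow> f (x - y) = f x - f y"
  using clinear_add[of f x "- y"] clinear_minus[of f y] by simp

lemma clinear_sum: "clinear f \<Longrightarrow> f (sum g A) = (\<Sum>a\<in>A. f (g a))"
  by (induction A rule: infinite_finite_induct) (simp_all add: clinear_0 clinear_add)

instantiation complex :: complex_vector
begin
definition scaleC_complex :: "complex \<Rightarrow> complex \<Rightarrow> complex" where [simp]: "scaleC_complex c x = c * x"
instance by standard (simp_all add: algebra_simps)
end

instantiation vec :: (complex_vector, finite) complex_vector
begin
definition scaleC_vec :: "complex \<Rightarrow> 'a ^ 'b \<Rightarrow> 'a ^ 'b" where "scaleC_vec c x = (\<chi> i. c *\<^sub>C x $ i)"
instance
  by standard (simp_all add: scaleC_vec_def vec_eq_iff scaleC_add_right scaleC_add_left scaleC_scaleC scaleC_one)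
end

instantiation "fun" :: (type, complex_vector) complex_vector
begin
definition scaleC_fun :: "complex \<Rightarrow> ('a \<Rightarrow> 'b) \<Rightarrow> 'a \<Rightarrow> 'b" where "scaleC_fun c f = (\<lambda>x. c *\<^sub>C f x)"
instance
  by standard (simp_all add: scaleC_fun_def fun_eq_iff scaleC_add_right scaleC_add_left scaleC_scaleC scaleC_one)
end

lemma scaleC_fun_apply [simp]: "(c *\<^sub>C f) x = c *\<^sub>C f x"
  by (simp add: scaleC_fun_def)

instantiation prod :: (complex_vector, complex_vector) complex_vector
begin
definition scaleC_prod :: "complex \<Rightarrow> 'a \<times> 'b \<Rightarrow> 'a \<times> 'b" where
  "scaleC_prod c p = (c *\<^sub>C fst p, c *\<^sub>C snd p)"
instance
  by standard (simp_all add: scaleC_prod_def prod_eq_iff scaleC_add_right scaleC_add_left scaleC_scaleC scaleC_one)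
end

lemma scaleC_Pair [simp]: "c *\<^sub>C (x, y) = (c *\<^sub>C x, c *\<^sub>C y)"
  by (simp add: scaleC_prod_def)

instantiation poly_mapping :: (type, complex_vector) complex_vector
begin
lift_definition scaleC_poly_mapping :: "complex \<Rightarrow> ('a \<Rightarrow>\<^sub>0 'b) \<Rightarrow> ('a \<Rightarrow>\<^sub>0 'b)"
  is "\<lambda>c f k. c *\<^sub>C f k"
proof -
  fix c :: complex and f :: "'a \<Rightarrow> 'b"
  assume "finite {x. f x \<noteq> 0}"
  then show "finite {x. c *\<^sub>C f x \<noteq> 0}" by (rule rev_finite_subset) auto
qed
instance
  by standard (transfer, simp add: scaleC_add_right scaleC_add_left scaleC_scaleC scaleC_one)+
end

lemma lookup_scaleC [simp]: "Poly_Mapping.lookup (c *\<^sub>C p) k = c *\<^sub>C Poly_Mapping.lookup p k"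
  by transfer simp

lemma scaleC_single: "c *\<^sub>C Poly_Mapping.single k x = Poly_Mapping.single k (c *\<^sub>C x)"
  by (rule poly_mapping_eqI) (simp add: lookup_single when_def)

lemma poly_mapping_sum_single:
  "p = (\<Sum>k\<in>Poly_Mapping.keys p. Poly_Mapping.single k (Poly_Mapping.lookup p k))"
  by (rule poly_mapping_eqI)
    (auto simp: lookup_sum lookup_single when_def sum.delta in_keys_iff split: if_splits)


section \<open>Commutative complex algebras and complex Lie algebras\<close>

text \<open>
  \<^class>\<open>comm_ring_1\<close> excludes only the zero algebra, whose tensor product with anything vanishes, so
  that nothing acts non-trivially over it.
\<close>

class complex_comm_algebra_1 = complex_vector + comm_ring_1 +
  assumes mult_scaleC_left: "(a *\<^sub>C x) * y = a *\<^sub>C (x * y)"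

lemma mult_scaleC_right: "x * (a *\<^sub>C y) = a *\<^sub>C (x * y)" for x :: "'a::complex_comm_algebra_1"
  by (metis mult.commute mult_scaleC_left)

definition subalgebra :: "'b::complex_comm_algebra_1 set \<Rightarrow> bool" where
  "subalgebra A \<longleftrightarrow> complex_vector.subspace A \<and> 1 \<in> A \<and> (\<forall>x\<in>A. \<forall>y\<in>A. x * y \<in> A)"

class complex_lie_algebra = complex_vector +
  fixes lie_bracket :: "'a \<Rightarrow> 'a \<Rightarrow> 'a"
  assumes lie_add_left: "lie_bracket (x + y) z = lie_bracket x z + lie_bracket y z"
    and lie_add_right: "lie_bracket z (x + y) = lie_bracket z x + lie_bracket z y"
    and lie_scale_left: "lie_bracket (c *\<^sub>C x) z = c *\<^sub>C lie_bracket x z"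
    and lie_scale_right: "lie_bracket z (c *\<^sub>C x) = c *\<^sub>C lie_bracket z x"
    and lie_self: "lie_bracket x x = 0"
    and lie_jacobi: "lie_bracket x (lie_bracket y z) + lie_bracket y (lie_bracket z x)
                     + lie_bracket z (lie_bracket x y) = 0"

lemma lie_anticommute: "lie_bracket x y = - lie_bracket y x" for x :: "'a::complex_lie_algebra"
proof -
  have "lie_bracket (x + y) (x + y) = 0" by (rule lie_self)
  then have "lie_bracket x y + lie_bracket y x = 0"
    by (simp only: lie_add_left lie_add_right lie_self[of x] lie_self[of y]) (simp add: add.commute)
  then show ?thesis by (simp add: eq_neg_iff_add_eq_0)
qed

lemma cbilinear_lie_bracket: "cbilinear (lie_bracket :: 'a::complex_lie_algebra \<Rightarrow> _)"
  unfolding cbilinear_def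
  by (auto intro!: clinearI simp: lie_add_left lie_add_right lie_scale_left lie_scale_right)


section \<open>Tensor products\<close>

text \<open>
  The usual construction: the free vector space on pairs modulo the subspace generated by the
  bilinearity relations.
\<close>

definition tensor_relations ::
    "(('a::complex_vector \<times> 'b::complex_vector) \<Rightarrow>\<^sub>0 complex) set" where
  "tensor_relations = complex_vector.span
     (range (\<lambda>(x, y, b). Poly_Mapping.single (x + y, b) 1
                          - Poly_Mapping.single (x, b) 1 - Poly_Mapping.single (y, b) 1)
    \<union> range (\<lambda>(x, a, b). Poly_Mapping.single (x, a + b) 1
                          - Poly_Mapping.single (x, a) 1 - Poly_Mapping.single (x, b) 1)
    \<union> range (\<lambda>(c, x, b). Poly_Mapping.single (c *\<^sub>C x, b) 1 - c *\<^sub>C Poly_Mapping.single (x, b) 1)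
    \<union> range (\<lambda>(c, x, b). Poly_Mapping.single (x, c *\<^sub>C b) 1 - c *\<^sub>C Poly_Mapping.single (x, b) 1))"

lemma subspace_tensor_relations: "complex_vector.subspace tensor_relations"
  by (simp add: tensor_relations_def)

definition tensor_eq ::
    "(('a::complex_vector \<times> 'b::complex_vector) \<Rightarrow>\<^sub>0 complex)
      \<Rightarrow> (('a \<times> 'b) \<Rightarrow>\<^sub>0 complex) \<Rightarrow> bool" where
  "tensor_eq p q \<longleftrightarrow> p - q \<in> tensor_relations"

lemma equivp_tensor_eq: "equivp tensor_eq"
proof (rule equivpI)
  show "reflp tensor_eq"
    by (auto intro!: reflpI simp: tensor_eq_def complex_vector.subspace_0[OF subspace_tensor_relations])
  show "symp tensor_eq"
    using complex_vector.subspace_neg[OF subspace_tensor_relations]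
    by (fastforce intro!: sympI simp: tensor_eq_def)
  show "transp tensor_eq"
    using complex_vector.subspace_add[OF subspace_tensor_relations]
    by (fastforce intro!: transpI simp: tensor_eq_def)
qed

quotient_type (overloaded) ('a, 'b) tensor =
  "(('a::complex_vector \<times> 'b::complex_vector) \<Rightarrow>\<^sub>0 complex)" / tensor_eq
  by (rule equivp_tensor_eq)

instantiation tensor :: (complex_vector, complex_vector) complex_vector
begin

lift_definition zero_tensor :: "('a, 'b) tensor" is 0 .

lift_definition plus_tensor :: "('a, 'b) tensor \<Rightarrow> ('a, 'b) tensor \<Rightarrow> ('a, 'b) tensor" is "(+)"
  using complex_vector.subspace_add[OF subspace_tensor_relations]
  by (fastforce simp: tensor_eq_def algebra_simps)

lift_definition minus_tensor :: "('a, 'b) tensor \<Rightarrow> ('a, 'b) tensor \<Rightarrow> ('a, 'b) tensor" is "(-)"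
proof -
  fix p p' q q' :: "('a \<times> 'b) \<Rightarrow>\<^sub>0 complex"
  assume "tensor_eq p p'" "tensor_eq q q'"
  then have "(p - p') - (q - q') \<in> tensor_relations"
    unfolding tensor_eq_def by (rule complex_vector.subspace_diff[OF subspace_tensor_relations])
  moreover have "(p - p') - (q - q') = (p - q) - (p' - q')" by simp
  ultimately show "tensor_eq (p - q) (p' - q')" by (simp add: tensor_eq_def)
qed

lift_definition uminus_tensor :: "('a, 'b) tensor \<Rightarrow> ('a, 'b) tensor" is uminus
proof -
  fix p p' :: "('a \<times> 'b) \<Rightarrow>\<^sub>0 complex"
  assume "tensor_eq p p'"
  then have "- (p - p') \<in> tensor_relations"
    unfolding tensor_eq_def by (rule complex_vector.subspace_neg[OF subspace_tensor_relations])
  then show "tensor_eq (- p) (- p')" by (simp add: tensor_eq_def)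
qed

lift_definition scaleC_tensor :: "complex \<Rightarrow> ('a, 'b) tensor \<Rightarrow> ('a, 'b) tensor" is scaleC
proof -
  fix c and p p' :: "('a \<times> 'b) \<Rightarrow>\<^sub>0 complex"
  assume "tensor_eq p p'"
  then have "c *\<^sub>C (p - p') \<in> tensor_relations"
    unfolding tensor_eq_def by (rule complex_vector.subspace_scale[OF subspace_tensor_relations])
  then show "tensor_eq (c *\<^sub>C p) (c *\<^sub>C p')"
    by (simp add: tensor_eq_def complex_vector.scale_right_diff_distrib)
qed

instance
proof
  have refl: "tensor_eq p p" for p :: "('a \<times> 'b) \<Rightarrow>\<^sub>0 complex"
    using equivp_reflp[OF equivp_tensor_eq] .
  fix x y z :: "('a, 'b) tensor" and a b :: complex
  show "x + y + z = x + (y + z)" by transfer (simp add: add.assoc refl)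
  show "x + y = y + x" by transfer (simp add: add.commute refl)
  show "0 + x = x" by transfer (simp add: refl)
  show "- x + x = 0" by transfer (simp add: refl)
  show "x - y = x + - y" by transfer (simp add: refl)
  show "a *\<^sub>C (x + y) = a *\<^sub>C x + a *\<^sub>C y" by transfer (simp add: refl scaleC_add_right)
  show "(a + b) *\<^sub>C x = a *\<^sub>C x + b *\<^sub>C x" by transfer (simp add: refl scaleC_add_left)
  show "a *\<^sub>C b *\<^sub>C x = (a * b) *\<^sub>C x" by transfer (simp add: refl)
  show "1 *\<^sub>C x = x" by transfer (simp add: refl)
qed

end

lift_definition tensor_of :: "'a::complex_vector \<Rightarrow> 'b::complex_vector \<Rightarrow> ('a, 'b) tensor"
    (infixr \<open>\<otimes>\<^sub>C\<close> 73)
  is "\<lambda>x b. Poly_Mapping.single (x, b) 1" .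

lemma tensor_of_add_left: "(x + y) \<otimes>\<^sub>C b = x \<otimes>\<^sub>C b + y \<otimes>\<^sub>C b"
proof -
  have "Poly_Mapping.single (x + y, b) 1 - Poly_Mapping.single (x, b) 1 - Poly_Mapping.single (y, b) 1
      \<in> tensor_relations"
    unfolding tensor_relations_def
    by (intro complex_vector.span_base UnI1, rule range_eqI[of _ _ "(x, y, b)"]) simp
  then show ?thesis by transfer (simp only: tensor_eq_def diff_diff_eq)
qed

lemma tensor_of_add_right: "x \<otimes>\<^sub>C (a + b) = x \<otimes>\<^sub>C a + x \<otimes>\<^sub>C b"
proof -
  have "Poly_Mapping.single (x, a + b) 1 - Poly_Mapping.single (x, a) 1 - Poly_Mapping.single (x, b) 1
      \<in> tensor_relations"
    unfolding tensor_relations_def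
    by (rule complex_vector.span_base, rule UnI1, rule UnI1, rule UnI2,
        rule range_eqI[of _ _ "(x, a, b)"]) simp
  then show ?thesis by transfer (simp only: tensor_eq_def diff_diff_eq)
qed

lemma tensor_of_scale_left: "(c *\<^sub>C x) \<otimes>\<^sub>C b = c *\<^sub>C (x \<otimes>\<^sub>C b)"
proof -
  have "Poly_Mapping.single (c *\<^sub>C x, b) 1 - c *\<^sub>C Poly_Mapping.single (x, b) 1 \<in> tensor_relations"
    unfolding tensor_relations_def
    by (rule complex_vector.span_base, rule UnI1, rule UnI2, rule range_eqI[of _ _ "(c, x, b)"]) simp
  then show ?thesis by transfer (simp only: tensor_eq_def)
qed

lemma tensor_of_scale_right: "x \<otimes>\<^sub>C (c *\<^sub>C b) = c *\<^sub>C (x \<otimes>\<^sub>C b)"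
proof -
  have "Poly_Mapping.single (x, c *\<^sub>C b) 1 - c *\<^sub>C Poly_Mapping.single (x, b) 1 \<in> tensor_relations"
    unfolding tensor_relations_def
    by (rule complex_vector.span_base, rule UnI2, rule range_eqI[of _ _ "(c, x, b)"]) simp
  then show ?thesis by transfer (simp only: tensor_eq_def)
qed

lemma cbilinear_tensor_of: "cbilinear (\<otimes>\<^sub>C)"
  unfolding cbilinear_def
  by (auto intro!: clinearI simp: tensor_of_add_left tensor_of_add_right
      tensor_of_scale_left tensor_of_scale_right)

lemma span_tensor_of:
  "complex_vector.span (range (\<lambda>(x, b). x \<otimes>\<^sub>C b)) = (UNIV :: ('a::complex_vector, 'b::complex_vector) tensor set)"
proof -
  have "abs_tensor p \<in> complex_vector.span (range (\<lambda>(x, b). x \<otimes>\<^sub>C b))"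
    for p :: "('a \<times> 'b) \<Rightarrow>\<^sub>0 complex"
  proof -
    have add: "abs_tensor (p + q) = abs_tensor p + abs_tensor q" for p q :: "('a \<times> 'b) \<Rightarrow>\<^sub>0 complex"
      by (simp add: plus_tensor.abs_eq)
    have zero: "abs_tensor (0 :: ('a \<times> 'b) \<Rightarrow>\<^sub>0 complex) = 0" by (simp add: zero_tensor.abs_eq)
    have sum: "abs_tensor (sum f A) = (\<Sum>k\<in>A. abs_tensor (f k))"
      for f :: "'a \<times> 'b \<Rightarrow> (('a \<times> 'b) \<Rightarrow>\<^sub>0 complex)" and A
      by (induction A rule: infinite_finite_induct) (simp_all add: add zero)
    have single: "abs_tensor (Poly_Mapping.single k c) = c *\<^sub>C (fst k \<otimes>\<^sub>C snd k)" for k :: "'a \<times> 'b" and c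
    proof -
      have eq: "Poly_Mapping.single k c = c *\<^sub>C Poly_Mapping.single (fst k, snd k) 1"
        by (simp add: scaleC_single)
      show ?thesis by (subst eq) (simp only: tensor_of.abs_eq scaleC_tensor.abs_eq)
    qed
    have "abs_tensor p = (\<Sum>k\<in>Poly_Mapping.keys p. Poly_Mapping.lookup p k *\<^sub>C (fst k \<otimes>\<^sub>C snd k))"
      by (subst poly_mapping_sum_single) (simp only: sum single)
    also have "\<dots> \<in> complex_vector.span (range (\<lambda>(x, b). x \<otimes>\<^sub>C b))"
      by (intro complex_vector.span_sum complex_vector.span_scale complex_vector.span_base)
        (auto simp: image_iff)
    finally show ?thesis .
  qed
  then have "t \<in> complex_vector.span (range (\<lambda>(x, b). x \<otimes>\<^sub>C b))" for t :: "('a, 'b) tensor"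
    using Quotient_abs_rep[OF Quotient_tensor, of t] by metis
  then show ?thesis by blast
qed

lemma tensor_induct [case_names pure add scale]:
  fixes t :: "('a::complex_vector, 'b::complex_vector) tensor"
  assumes "\<And>x b. P (x \<otimes>\<^sub>C b)" "\<And>s t. P s \<Longrightarrow> P t \<Longrightarrow> P (s + t)" "\<And>c t. P t \<Longrightarrow> P (c *\<^sub>C t)"
  shows "P t"
proof -
  have "P 0" using assms(3)[of "0 \<otimes>\<^sub>C 0" 0] assms(1) by simp
  have "t \<in> complex_vector.span (range (\<lambda>(x, b). x \<otimes>\<^sub>C b))" by (simp add: span_tensor_of)
  then show ?thesis
  proof (induction rule: complex_vector.span_induct_alt)
    case base then show ?case by fact
  next
    case (step c x y)
    then show ?case using assms by auto
  qed
qed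

text \<open>
  The linear map induced by a bilinear map; it is independent of the chosen representative, and
  hence meaningful, only for bilinear \<open>h\<close>.
\<close>

definition tensor_lift ::
    "('a::complex_vector \<Rightarrow> 'b::complex_vector \<Rightarrow> 'c::complex_vector) \<Rightarrow> ('a, 'b) tensor \<Rightarrow> 'c" where
  "tensor_lift h t = (\<Sum>k\<in>Poly_Mapping.keys (rep_tensor t).
     Poly_Mapping.lookup (rep_tensor t) k *\<^sub>C h (fst k) (snd k))"

context
  fixes h :: "'a::complex_vector \<Rightarrow> 'b::complex_vector \<Rightarrow> 'c::complex_vector"
  assumes h: "cbilinear h"
begin

private definition ev :: "(('a \<times> 'b) \<Rightarrow>\<^sub>0 complex) \<Rightarrow> 'c" where
  "ev p = (\<Sum>k\<in>Poly_Mapping.keys p. Poly_Mapping.lookup p k *\<^sub>C h (fst k) (snd k))"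

private lemma ev_superset:
  "finite A \<Longrightarrow> Poly_Mapping.keys p \<subseteq> A
    \<Longrightarrow> ev p = (\<Sum>k\<in>A. Poly_Mapping.lookup p k *\<^sub>C h (fst k) (snd k))"
  unfolding ev_def by (rule sum.mono_neutral_left) (auto simp: in_keys_iff)

private lemma clinear_ev: "clinear ev"
proof (rule clinearI)
  fix p q :: "('a \<times> 'b) \<Rightarrow>\<^sub>0 complex" and c
  let ?A = "Poly_Mapping.keys p \<union> Poly_Mapping.keys q"
  have "Poly_Mapping.keys (p + q) \<subseteq> ?A" by (rule Poly_Mapping.keys_add)
  then show "ev (p + q) = ev p + ev q"
    by (simp add: ev_superset[of ?A] lookup_add scaleC_add_left sum.distrib)
  have "Poly_Mapping.keys (c *\<^sub>C p) \<subseteq> Poly_Mapping.keys p" by (auto simp: in_keys_iff)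
  then show "ev (c *\<^sub>C p) = c *\<^sub>C ev p"
    by (simp add: ev_superset[of "Poly_Mapping.keys p"] complex_vector.scale_sum_right)
qed

private lemma ev_single: "ev (Poly_Mapping.single (x, b) c) = c *\<^sub>C h x b"
  by (simp add: ev_def)

private lemma h_simps:
  "h (x + y) b = h x b + h y b" "h x (a + b) = h x a + h x b"
  "h (c *\<^sub>C x) b = c *\<^sub>C h x b" "h x (c *\<^sub>C b) = c *\<^sub>C h x b"
  using h by (simp_all add: cbilinear_def Vector_Spaces.linear_iff)

private lemma ev_relations: "p \<in> tensor_relations \<Longrightarrow> ev p = 0"
  unfolding tensor_relations_def
proof (induction rule: complex_vector.span_induct_alt)
  case base
  then show ?case by (simp add: clinear_0[OF clinear_ev])
next
  case (step c x y)
  then have "ev x = 0"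
    by (auto simp: clinear_diff[OF clinear_ev] clinear_scale[OF clinear_ev] ev_single h_simps)
  then show ?case
    using step by (simp add: clinear_add[OF clinear_ev] clinear_scale[OF clinear_ev])
qed

private lemma lift_abs: "tensor_lift h (abs_tensor p) = ev p"
proof -
  have "tensor_eq (rep_tensor (abs_tensor p)) p"
    by (meson Quotient_rep_abs Quotient_tensor equivp_reflp equivp_tensor_eq)
  then have "ev (rep_tensor (abs_tensor p) - p) = 0" by (simp add: tensor_eq_def ev_relations)
  then have "ev (rep_tensor (abs_tensor p)) = ev p" by (simp only: clinear_diff[OF clinear_ev]) simp
  then show ?thesis by (simp add: tensor_lift_def ev_def)
qed

lemma tensor_lift_of: "tensor_lift h (x \<otimes>\<^sub>C b) = h x b"
  by (simp add: tensor_of.abs_eq lift_abs ev_single)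

lemma clinear_tensor_lift: "clinear (tensor_lift h)"
proof (rule clinearI)
  fix s t :: "('a, 'b) tensor" and c
  obtain p q where [simp]: "s = abs_tensor p" "t = abs_tensor q"
    by (metis Quotient_abs_rep Quotient_tensor)
  show "tensor_lift h (s + t) = tensor_lift h s + tensor_lift h t"
    by (simp add: plus_tensor.abs_eq lift_abs clinear_add[OF clinear_ev])
  show "tensor_lift h (c *\<^sub>C s) = c *\<^sub>C tensor_lift h s"
    by (simp add: scaleC_tensor.abs_eq lift_abs clinear_scale[OF clinear_ev])
qed

end

lemma tensor_lift_add_fun:
  "tensor_lift (\<lambda>x b. h x b + k x b) t = tensor_lift h t + tensor_lift k t"
  by (simp add: tensor_lift_def scaleC_add_right sum.distrib)

lemma tensor_lift_scale_fun: "tensor_lift (\<lambda>x b. c *\<^sub>C h x b) t = c *\<^sub>C tensor_lift h t"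
  by (simp add: tensor_lift_def complex_vector.scale_sum_right mult.commute)

lemma cbilinear_bracket_inner: "cbilinear (\<lambda>y c. lie_bracket x y \<otimes>\<^sub>C (b * c))"
  for x :: "'a::complex_lie_algebra" and b :: "'b::complex_comm_algebra_1"
  unfolding cbilinear_def
  by (auto intro!: clinearI simp: tensor_of_add_left tensor_of_add_right tensor_of_scale_left
      tensor_of_scale_right lie_add_right lie_scale_right distrib_left mult_scaleC_right)

lemma cbilinear_bracket_outer:
  "cbilinear (\<lambda>x b. tensor_lift (\<lambda>y c. lie_bracket x y \<otimes>\<^sub>C (b * c)) t)"
  for t :: "('a::complex_lie_algebra, 'b::complex_comm_algebra_1) tensor"
  unfolding cbilinear_def
  by (auto intro!: clinearI simp: lie_add_left lie_scale_left tensor_of_add_left tensor_of_add_right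
      tensor_of_scale_left tensor_of_scale_right distrib_right mult_scaleC_left
      tensor_lift_add_fun tensor_lift_scale_fun)

instantiation tensor :: (complex_lie_algebra, complex_comm_algebra_1) complex_lie_algebra
begin

definition lie_bracket_tensor :: "('a, 'b) tensor \<Rightarrow> ('a, 'b) tensor \<Rightarrow> ('a, 'b) tensor" where
  "lie_bracket_tensor s t =
     tensor_lift (\<lambda>x b. tensor_lift (\<lambda>y c. lie_bracket x y \<otimes>\<^sub>C (b * c)) t) s"

instance
proof
  note inner = cbilinear_bracket_inner and outer = cbilinear_bracket_outer
  note inner_simps = clinear_add[OF clinear_tensor_lift[OF inner]]
    clinear_scale[OF clinear_tensor_lift[OF inner]] tensor_lift_of[OF inner]
  have pr: "lie_bracket (x \<otimes>\<^sub>C b) (y \<otimes>\<^sub>C c) = lie_bracket x y \<otimes>\<^sub>C (b * c)" for x y :: 'a and b c :: 'b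
    unfolding lie_bracket_tensor_def by (subst tensor_lift_of[OF outer]) (rule tensor_lift_of[OF inner])
  have addl: "lie_bracket (x + y) z = lie_bracket x z + lie_bracket y z"
    and scalel: "lie_bracket (c *\<^sub>C x) z = c *\<^sub>C lie_bracket x z" for x y z :: "('a, 'b) tensor" and c
    by (simp_all add: lie_bracket_tensor_def clinear_add[OF clinear_tensor_lift[OF outer]]
        clinear_scale[OF clinear_tensor_lift[OF outer]])
  have pureL: "lie_bracket (x \<otimes>\<^sub>C b) t = tensor_lift (\<lambda>y c. lie_bracket x y \<otimes>\<^sub>C (b * c)) t"
    for x :: 'a and b :: 'b and t
    unfolding lie_bracket_tensor_def by (rule tensor_lift_of[OF outer])
  have addr: "lie_bracket z (x + y) = lie_bracket z x + lie_bracket z y" for x y z :: "('a, 'b) tensor"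
    by (induction z rule: tensor_induct) (simp_all add: addl scalel scaleC_add_right pureL inner_simps)
  have scaler: "lie_bracket z (c *\<^sub>C x) = c *\<^sub>C lie_bracket z x" for x z :: "('a, 'b) tensor" and c
    by (induction z rule: tensor_induct)
      (simp_all add: addl scalel scaleC_add_right pureL inner_simps mult.commute)
  have anti: "lie_bracket x y = - lie_bracket y x" for x y :: "('a, 'b) tensor"
  proof (induction x rule: tensor_induct)
    case (pure x b)
    show ?case
    proof (induction y rule: tensor_induct)
      case (pure y c)
      have "lie_bracket x y \<otimes>\<^sub>C (b * c) = (- 1 *\<^sub>C lie_bracket y x) \<otimes>\<^sub>C (c * b)"
        by (subst lie_anticommute) (simp add: mult.commute)
      also have "\<dots> = - (lie_bracket y x \<otimes>\<^sub>C (c * b))"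
        by (simp only: tensor_of_scale_left) simp
      finally show ?case by (simp add: pr)
    qed (simp_all add: addl addr scalel scaler)
  qed (simp_all add: addl addr scalel scaler)
  define J where "J x y z = lie_bracket x (lie_bracket y z) + lie_bracket y (lie_bracket z x)
      + lie_bracket z (lie_bracket x y)" for x y z :: "('a, 'b) tensor"
  have J_add: "J (s + t) y z = J s y z + J t y z" "J x (s + t) z = J x s z + J x t z"
      "J x y (s + t) = J x y s + J x y t" for x y z s t
    by (simp_all add: J_def addl addr ac_simps)
  have J_scale: "J (c *\<^sub>C x) y z = c *\<^sub>C J x y z" "J x (c *\<^sub>C y) z = c *\<^sub>C J x y z"
      "J x y (c *\<^sub>C z) = c *\<^sub>C J x y z" for x y z c
    by (simp_all add: J_def scalel scaler scaleC_add_right)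
  have J_pure: "J (x \<otimes>\<^sub>C b) (y \<otimes>\<^sub>C c) (z \<otimes>\<^sub>C d) = 0" for x y z b c d
  proof -
    have eq: "c * (d * b) = b * (c * d)" "d * (b * c) = b * (c * d)" by (simp_all add: ac_simps)
    have "J (x \<otimes>\<^sub>C b) (y \<otimes>\<^sub>C c) (z \<otimes>\<^sub>C d) = (lie_bracket x (lie_bracket y z)
        + lie_bracket y (lie_bracket z x) + lie_bracket z (lie_bracket x y)) \<otimes>\<^sub>C (b * (c * d))"
      by (simp only: J_def pr eq tensor_of_add_left)
    also have "\<dots> = 0 \<otimes>\<^sub>C (b * (c * d))" by (simp only: lie_jacobi)
    also have "\<dots> = 0" using tensor_of_scale_left[of 0 0] by simp
    finally show ?thesis .
  qed
  have jac: "J x y z = 0" for x y z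
  proof (induction x rule: tensor_induct)
    case x: (pure x b)
    show ?case
    proof (induction y rule: tensor_induct)
      case y: (pure y c)
      show ?case
        by (induction z rule: tensor_induct) (simp_all add: J_pure J_add J_scale)
    qed (simp_all add: J_add J_scale)
  qed (simp_all add: J_add J_scale)
  fix x y z :: "('a, 'b) tensor" and c
  show "lie_bracket (x + y) z = lie_bracket x z + lie_bracket y z" by (rule addl)
  show "lie_bracket z (x + y) = lie_bracket z x + lie_bracket z y" by (rule addr)
  show "lie_bracket (c *\<^sub>C x) z = c *\<^sub>C lie_bracket x z" by (rule scalel)
  show "lie_bracket z (c *\<^sub>C x) = c *\<^sub>C lie_bracket z x" by (rule scaler)
  show "lie_bracket x (lie_bracket y z) + lie_bracket y (lie_bracket z x)
      + lie_bracket z (lie_bracket x y) = 0" using jac unfolding J_def .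
  have "lie_bracket x x + lie_bracket x x = 0"
    using anti[of x x] by (simp only: eq_neg_iff_add_eq_0)
  then have "2 *\<^sub>C lie_bracket x x = 0"
    using scaleC_add_left[of 1 1 "lie_bracket x x"] by simp
  then show "lie_bracket x x = 0" by simp
qed

end

lemma lie_bracket_tensor_of:
  "lie_bracket (x \<otimes>\<^sub>C b) (y \<otimes>\<^sub>C c) = lie_bracket x y \<otimes>\<^sub>C (b * c)"
  for x y :: "'a::complex_lie_algebra" and b c :: "'b::complex_comm_algebra_1"
  unfolding lie_bracket_tensor_def
  by (subst tensor_lift_of[OF cbilinear_bracket_outer]) (rule tensor_lift_of[OF cbilinear_bracket_inner])


section \<open>The Lie algebra $\mathcal{S}_N \ltimes A_N$\<close>

type_synonym 'n laurent = "(int ^ 'n) \<Rightarrow>\<^sub>0 complex"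

definition tpow :: "int ^ 'n \<Rightarrow> 'n::finite laurent" where
  "tpow m = Poly_Mapping.single m 1"

definition pairing :: "complex ^ 'n \<Rightarrow> int ^ 'n::finite \<Rightarrow> complex" where
  "pairing u r = (\<Sum>i\<in>UNIV. u $ i * of_int (r $ i))"

text \<open>\<open>euler i\<close> is $d_i = t_i \frac{d}{dt_i}$, and \<open>vfield u r\<close> is $D(u, r)$.\<close>

definition euler :: "'n \<Rightarrow> 'n::finite laurent \<Rightarrow> 'n laurent" where
  "euler i = Poly_Mapping.mapp (\<lambda>m c. of_int (m $ i) * c)"

definition vfield :: "complex ^ 'n \<Rightarrow> int ^ 'n \<Rightarrow> 'n::finite laurent \<Rightarrow> 'n laurent" where
  "vfield u r = (\<lambda>f. \<Sum>i\<in>UNIV. u $ i *\<^sub>C (tpow r * euler i f))"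

definition div_free :: "('n::finite laurent \<Rightarrow> 'n laurent) set" where
  "div_free = complex_vector.span {vfield u r | u r. pairing u r = 0}"

definition commutator :: "('a \<Rightarrow> 'a) \<Rightarrow> ('a \<Rightarrow> 'a) \<Rightarrow> 'a \<Rightarrow> 'a::complex_vector" where
  "commutator X Y = (\<lambda>f. X (Y f) - Y (X f))"

lemma subspace_div_free: "complex_vector.subspace div_free"
  by (simp add: div_free_def)

lemma lookup_euler: "Poly_Mapping.lookup (euler i f) m = of_int (m $ i) * Poly_Mapping.lookup f m"
  by (simp add: euler_def lookup_mapp when_def in_keys_iff)

lemma clinear_euler: "clinear (euler i)"
  by (rule clinearI; rule poly_mapping_eqI) (simp_all add: lookup_euler lookup_add algebra_simps)

lemma euler_tpow: "euler i (tpow m) = of_int (m $ i) *\<^sub>C tpow m"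
  by (rule poly_mapping_eqI) (simp add: lookup_euler tpow_def lookup_single when_def)

lemma tpow_mult: "tpow m * tpow n = tpow (m + n)"
  by (simp add: tpow_def mult_single)

lemma laurent_mult_scaleC: "f * (c *\<^sub>C g) = c *\<^sub>C (f * g)" for f g :: "'n::finite laurent"
proof -
  have "c *\<^sub>C h = Poly_Mapping.single 0 c * h" for h :: "'n laurent"
  proof -
    have "c *\<^sub>C h = (\<Sum>k\<in>Poly_Mapping.keys h. Poly_Mapping.single k (c * Poly_Mapping.lookup h k))"
      by (subst poly_mapping_sum_single[of h]) (simp add: complex_vector.scale_sum_right scaleC_single)
    also have "\<dots> = Poly_Mapping.single 0 c * (\<Sum>k\<in>Poly_Mapping.keys h. Poly_Mapping.single k (Poly_Mapping.lookup h k))"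
      by (simp add: sum_distrib_left mult_single)
    finally show ?thesis by (simp only: poly_mapping_sum_single[of h, symmetric])
  qed
  then show ?thesis by (simp add: ac_simps)
qed

lemma clinear_vfield: "clinear (vfield u r)"
  by (rule clinearI)
    (simp_all add: vfield_def clinear_add[OF clinear_euler] clinear_scale[OF clinear_euler]
      distrib_left laurent_mult_scaleC scaleC_add_right sum.distrib complex_vector.scale_sum_right
      mult.commute)

lemma vfield_tpow: "vfield u r (tpow m) = pairing u m *\<^sub>C tpow (r + m)"
  by (simp add: vfield_def euler_tpow laurent_mult_scaleC tpow_mult pairing_def
      complex_vector.scale_sum_left)

lemma clinear_laurent_eqI:
  assumes "clinear X" "clinear Y" "\<And>m. X (tpow m) = Y (tpow m)"
  shows "X = (Y :: 'n::finite laurent \<Rightarrow> 'a::complex_vector)"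
proof
  fix f :: "'n laurent"
  have f: "f = (\<Sum>m\<in>Poly_Mapping.keys f. Poly_Mapping.lookup f m *\<^sub>C tpow m)"
    by (subst poly_mapping_sum_single) (simp add: tpow_def scaleC_single)
  show "X f = Y f"
    by (subst (1 2) f)
      (simp only: clinear_sum[OF assms(1)] clinear_sum[OF assms(2)]
        clinear_scale[OF assms(1)] clinear_scale[OF assms(2)] assms(3))
qed

lemma clinear_commutator: "clinear X \<Longrightarrow> clinear Y \<Longrightarrow> clinear (commutator X Y)"
  by (rule clinearI)
    (simp_all add: commutator_def clinear_add clinear_scale complex_vector.scale_right_diff_distrib)

lemma pairing_zero [simp]: "pairing u 0 = 0"
  by (simp add: pairing_def)

lemma pairing_add: "pairing u (r + s) = pairing u r + pairing u s"
  by (simp add: pairing_def algebra_simps sum.distrib)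

lemma pairing_bracket:
  "pairing (c *\<^sub>C v - d *\<^sub>C u) m = c * pairing v m - d * pairing u m"
  by (simp add: pairing_def scaleC_vec_def left_diff_distrib sum_subtractf sum_distrib_left mult.assoc)

lemma commutator_vfield:
  "commutator (vfield u r) (vfield v s)
     = vfield (pairing u s *\<^sub>C v - pairing v r *\<^sub>C u) (r + s)"
proof (rule clinear_laurent_eqI)
  fix m
  show "commutator (vfield u r) (vfield v s) (tpow m)
     = vfield (pairing u s *\<^sub>C v - pairing v r *\<^sub>C u) (r + s) (tpow m)"
    by (simp add: commutator_def vfield_tpow clinear_scale[OF clinear_vfield] pairing_bracket
        pairing_add ac_simps complex_vector.scale_left_diff_distrib[symmetric])
      (simp add: algebra_simps)
qed (intro clinear_commutator clinear_vfield)+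

lemma vfield_in_div_free: "pairing u r = 0 \<Longrightarrow> vfield u r \<in> div_free"
  unfolding div_free_def by (rule complex_vector.span_base) blast

lemma clinear_div_free: "X \<in> div_free \<Longrightarrow> clinear X"
  unfolding div_free_def
proof (induction rule: complex_vector.span_induct_alt)
  case base
  show ?case by (rule clinearI) simp_all
next
  case (step c X Y)
  then have "clinear X" using clinear_vfield by auto
  with step show ?case
    by (intro clinearI) (simp_all add: clinear_add clinear_scale algebra_simps scaleC_add_right)
qed

lemma commutator_div_free:
  assumes "X \<in> div_free" "Y \<in> div_free"
  shows "commutator X Y \<in> div_free"
proof -
  have gen: "commutator X (vfield v s) \<in> div_free"
    if "X \<in> div_free" "pairing v s = 0" for X v s
    using that(1)[unfolded div_free_def]
  proof (induction rule: complex_vector.span_induct_alt)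
    case base
    have "commutator 0 (vfield v s) = 0"
      by (simp add: commutator_def fun_eq_iff clinear_0[OF clinear_vfield])
    then show ?case by (simp only: complex_vector.subspace_0[OF subspace_div_free])
  next
    case (step c X Z)
    then obtain u r where X: "X = vfield u r" "pairing u r = 0" by auto
    have "commutator (c *\<^sub>C X + Z) (vfield v s) = c *\<^sub>C commutator X (vfield v s) + commutator Z (vfield v s)"
      by (simp add: commutator_def fun_eq_iff clinear_add[OF clinear_vfield] clinear_scale[OF clinear_vfield]
          complex_vector.scale_right_diff_distrib)
    moreover have "commutator X (vfield v s) \<in> div_free"
      unfolding X(1) commutator_vfield
      by (rule vfield_in_div_free) (simp add: pairing_bracket pairing_add X(2) \<open>pairing v s = 0\<close>)
    ultimately show ?case
      using step(2) complex_vector.subspace_add[OF subspace_div_free] complex_vector.subspace_scale[OF subspace_div_free]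
      by metis
  qed
  show ?thesis
    using assms(2)[unfolded div_free_def]
  proof (induction rule: complex_vector.span_induct_alt)
    case base
    have "commutator X 0 = 0"
      by (simp add: commutator_def fun_eq_iff clinear_0[OF clinear_div_free[OF assms(1)]])
    then show ?case by (simp only: complex_vector.subspace_0[OF subspace_div_free])
  next
    case (step c Y Z)
    have "commutator X (c *\<^sub>C Y + Z) = c *\<^sub>C commutator X Y + commutator X Z"
      by (simp add: commutator_def fun_eq_iff clinear_add[OF clinear_div_free[OF assms(1)]]
          clinear_scale[OF clinear_div_free[OF assms(1)]] complex_vector.scale_right_diff_distrib)
    moreover have "commutator X Y \<in> div_free" using step gen[OF assms(1)] by auto
    ultimately show ?case
      using step(2) complex_vector.subspace_add[OF subspace_div_free] complex_vector.subspace_scale[OF subspace_div_free]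
      by metis
  qed
qed

text \<open>The pair \<open>(X, f)\<close> stands for the element $X + f$ of $\mathcal{S}_N \ltimes A_N$.\<close>

typedef (overloaded) 'n SA = "{(X, f). X \<in> div_free} :: (('n::finite laurent \<Rightarrow> 'n laurent) \<times> 'n laurent) set"
  by (rule exI[of _ "(0, 0)"]) (simp add: complex_vector.subspace_0[OF subspace_div_free])

setup_lifting type_definition_SA

instantiation SA :: (finite) complex_lie_algebra
begin

lift_definition zero_SA :: "'a SA" is "(0, 0)"
  by (simp add: complex_vector.subspace_0[OF subspace_div_free])

lift_definition plus_SA :: "'a SA \<Rightarrow> 'a SA \<Rightarrow> 'a SA" is "(+)"
  by (auto intro: complex_vector.subspace_add[OF subspace_div_free])

lift_definition minus_SA :: "'a SA \<Rightarrow> 'a SA \<Rightarrow> 'a SA" is "(-)"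
  by (auto intro: complex_vector.subspace_diff[OF subspace_div_free])

lift_definition uminus_SA :: "'a SA \<Rightarrow> 'a SA" is uminus
  by (auto intro: complex_vector.subspace_neg[OF subspace_div_free])

lift_definition scaleC_SA :: "complex \<Rightarrow> 'a SA \<Rightarrow> 'a SA" is scaleC
  by (auto intro: complex_vector.subspace_scale[OF subspace_div_free])

lift_definition lie_bracket_SA :: "'a SA \<Rightarrow> 'a SA \<Rightarrow> 'a SA"
  is "\<lambda>(X, f) (Y, g). (commutator X Y, X g - Y f)"
  by (auto intro: commutator_div_free)

instance
proof
  fix x y z :: "'a SA" and a b c :: complex
  show "x + y + z = x + (y + z)" by transfer (simp add: add.assoc)
  show "x + y = y + x" by transfer (simp add: add.commute)
  show "0 + x = x" by transfer (simp add: prod_eq_iff)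
  show "- x + x = 0" by transfer (simp add: prod_eq_iff)
  show "x - y = x + - y" by transfer simp
  show "a *\<^sub>C (x + y) = a *\<^sub>C x + a *\<^sub>C y" by transfer (simp add: scaleC_add_right)
  show "(a + b) *\<^sub>C x = a *\<^sub>C x + b *\<^sub>C x" by transfer (simp add: scaleC_add_left)
  show "a *\<^sub>C b *\<^sub>C x = (a * b) *\<^sub>C x" by transfer simp
  show "1 *\<^sub>C x = x" by transfer simp
  show "lie_bracket (x + y) z = lie_bracket x z + lie_bracket y z"
    by transfer (auto simp: commutator_def fun_eq_iff algebra_simps dest!: clinear_div_free simp: clinear_add)
  show "lie_bracket z (x + y) = lie_bracket z x + lie_bracket z y"
    by transfer (auto simp: commutator_def fun_eq_iff algebra_simps dest!: clinear_div_free simp: clinear_add)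
  show "lie_bracket (c *\<^sub>C x) z = c *\<^sub>C lie_bracket x z"
    by transfer (auto simp: commutator_def fun_eq_iff complex_vector.scale_right_diff_distrib
        dest!: clinear_div_free simp: clinear_scale)
  show "lie_bracket z (c *\<^sub>C x) = c *\<^sub>C lie_bracket z x"
    by transfer (auto simp: commutator_def fun_eq_iff complex_vector.scale_right_diff_distrib
        dest!: clinear_div_free simp: clinear_scale)
  show "lie_bracket x x = 0"
    by transfer (auto simp: commutator_def fun_eq_iff)
  show "lie_bracket x (lie_bracket y z) + lie_bracket y (lie_bracket z x)
      + lie_bracket z (lie_bracket x y) = 0"
    by transfer (auto simp: commutator_def fun_eq_iff dest!: clinear_div_free simp: clinear_diff)
qed

end

text \<open>\<open>SA_D u r\<close> is $D(u, r)$; as an element of $\mathcal{S}_N$ it is meaningful only if \<open>pairing u r = 0\<close>.\<close>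

definition SA_D :: "complex ^ 'n \<Rightarrow> int ^ 'n \<Rightarrow> 'n::finite SA" where
  "SA_D u r = Abs_SA (vfield u r, 0)"

definition SA_t :: "int ^ 'n \<Rightarrow> 'n::finite SA" where
  "SA_t s = Abs_SA (0, tpow s)"

definition SA_d :: "'n \<Rightarrow> 'n::finite SA" where
  "SA_d i = Abs_SA (euler i, 0)"

lemma vfield_axis: "vfield (axis i 1) 0 = euler i"
proof
  fix f
  have "vfield (axis i 1) 0 f = (\<Sum>j\<in>UNIV. if j = i then euler j f else 0)"
    unfolding vfield_def by (rule sum.cong) (auto simp: axis_def tpow_def)
  then show "vfield (axis i 1) 0 f = euler i f" by simp
qed

lemma SA_d_eq: "SA_d i = SA_D (axis i 1) 0"
  by (simp add: SA_d_def SA_D_def vfield_axis)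

lemma lie_bracket_D_D:
  assumes "pairing u r = 0" "pairing v s = 0"
  shows "lie_bracket (SA_D u r) (SA_D v s) = SA_D (pairing u s *\<^sub>C v - pairing v r *\<^sub>C u) (r + s)"
proof -
  have "pairing (pairing u s *\<^sub>C v - pairing v r *\<^sub>C u) (r + s) = 0"
    by (simp add: pairing_bracket pairing_add assms)
  then show ?thesis
    using assms
    by (simp add: SA_D_def lie_bracket_SA.abs_eq eq_onp_def vfield_in_div_free commutator_vfield
        clinear_0[OF clinear_vfield])
qed

lemma lie_bracket_D_t:
  assumes "pairing u r = 0"
  shows "lie_bracket (SA_D u r) (SA_t s) = pairing u s *\<^sub>C SA_t (r + s)"
proof -
  have "commutator (vfield u r) 0 = 0"
    by (simp add: commutator_def fun_eq_iff clinear_0[OF clinear_vfield])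
  then show ?thesis
    using assms
    by (simp add: SA_D_def SA_t_def lie_bracket_SA.abs_eq scaleC_SA.abs_eq eq_onp_def
        vfield_in_div_free complex_vector.subspace_0[OF subspace_div_free] vfield_tpow)
qed

lemma lie_bracket_t_t: "lie_bracket (SA_t r) (SA_t s) = 0" for r s :: "int ^ 'n::finite"
proof -
  have "commutator 0 0 = (0 :: 'n laurent \<Rightarrow> 'n laurent)"
    by (simp add: commutator_def fun_eq_iff)
  then show ?thesis
    by (simp add: SA_t_def lie_bracket_SA.abs_eq zero_SA_def eq_onp_def
        complex_vector.subspace_0[OF subspace_div_free])
qed


section \<open>Modules\<close>

definition lie_module :: "('l::complex_lie_algebra \<Rightarrow> 'v::complex_vector \<Rightarrow> 'v) \<Rightarrow> bool" where
  "lie_module \<rho> \<longleftrightarrow> cbilinear \<rho> \<and> (\<forall>x y v. \<rho> (lie_bracket x y) v = \<rho> x (\<rho> y v) - \<rho> y (\<rho> x v))"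

definition lie_submodule :: "('l \<Rightarrow> 'v \<Rightarrow> 'v) \<Rightarrow> 'v::complex_vector set \<Rightarrow> bool" where
  "lie_submodule \<rho> W \<longleftrightarrow> complex_vector.subspace W \<and> (\<forall>x. \<forall>w\<in>W. \<rho> x w \<in> W)"

definition irreducible_module :: "('l \<Rightarrow> 'v \<Rightarrow> 'v::complex_vector) \<Rightarrow> bool" where
  "irreducible_module \<rho> \<longleftrightarrow> (UNIV :: 'v set) \<noteq> {0} \<and> (\<forall>W. lie_submodule \<rho> W \<longrightarrow> W = {0} \<or> W = UNIV)"

definition cartan :: "'n::finite SA set" where
  "cartan = complex_vector.span (range SA_d)"

text \<open>
  Linear functionals on a subspace \<open>H\<close>, represented by functions on the ambient space that vanish
  outside \<open>H\<close>, so that every functional has exactly one representative.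
\<close>

definition dual_space :: "'a::complex_vector set \<Rightarrow> ('a \<Rightarrow> complex) set" where
  "dual_space H = {f. (\<forall>x\<in>H. \<forall>y\<in>H. f (x + y) = f x + f y) \<and> (\<forall>c. \<forall>x\<in>H. f (c *\<^sub>C x) = c * f x)
                      \<and> (\<forall>x. x \<notin> H \<longrightarrow> f x = 0)}"

definition weight_space ::
    "(('n::finite SA, 'b::complex_comm_algebra_1) tensor \<Rightarrow> 'v::complex_vector \<Rightarrow> 'v)
      \<Rightarrow> ('n SA \<Rightarrow> complex) \<Rightarrow> 'v set" where
  "weight_space \<rho> \<mu> = {v. \<forall>h\<in>cartan. \<rho> (h \<otimes>\<^sub>C 1) v = \<mu> h *\<^sub>C v}"

definition is_weight ::
    "(('n::finite SA, 'b::complex_comm_algebra_1) tensor \<Rightarrow> 'v::complex_vector \<Rightarrow> 'v)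
      \<Rightarrow> ('n SA \<Rightarrow> complex) \<Rightarrow> bool" where
  "is_weight \<rho> \<mu> \<longleftrightarrow> \<mu> \<in> dual_space cartan \<and> weight_space \<rho> \<mu> \<noteq> {0}"

text \<open>The whole space is the internal direct sum of the subspaces \<open>W i\<close>, \<open>i \<in> I\<close>.\<close>

definition direct_sum_decomp :: "'i set \<Rightarrow> ('i \<Rightarrow> 'v::complex_vector set) \<Rightarrow> bool" where
  "direct_sum_decomp I W \<longleftrightarrow>
     (\<forall>i\<in>I. complex_vector.subspace (W i)) \<and>
     (\<forall>v. \<exists>!f. (\<forall>i\<in>I. f i \<in> W i) \<and> {i. f i \<noteq> 0} \<subseteq> I \<and> finite {i. f i \<noteq> 0}
                \<and> v = (\<Sum>i | f i \<noteq> 0. f i))"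

text \<open>Finite-dimensionality is required separately because \<open>dim\<close> is 0 on infinite-dimensional spaces.\<close>

definition uniformly_bounded_weight_module ::
    "(('n::finite SA, 'b::complex_comm_algebra_1) tensor \<Rightarrow> 'v::complex_vector \<Rightarrow> 'v) \<Rightarrow> bool" where
  "uniformly_bounded_weight_module \<rho> \<longleftrightarrow> lie_module \<rho> \<and>
     direct_sum_decomp (dual_space cartan) (weight_space \<rho>) \<and>
     (\<exists>M::nat. M > 0 \<and> (\<forall>\<mu>\<in>dual_space cartan.
        (\<exists>S. finite S \<and> weight_space \<rho> \<mu> \<subseteq> complex_vector.span S) \<and>
        complex_vector.dim (weight_space \<rho> \<mu>) \<le> M))"

text \<open>The weight space $V_\Lambda$ in coordinates, $\Lambda \in \mathbb{C}^N$.\<close>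

definition weight_space_coord ::
    "(('n::finite SA, 'b::complex_comm_algebra_1) tensor \<Rightarrow> 'v::complex_vector \<Rightarrow> 'v)
      \<Rightarrow> complex ^ 'n \<Rightarrow> 'v set" where
  "weight_space_coord \<rho> \<Lambda> = {v. \<forall>i. \<rho> (SA_d i \<otimes>\<^sub>C 1) v = \<Lambda> $ i *\<^sub>C v}"

end

theory Submission
  imports Defs "HOL-Computational_Algebra.Fundamental_Theorem_Algebra"
begin

text \<open>
  Write \<open>T m b\<close> and \<open>D u r b\<close> for the operators by which $t^m b$ and $D(u, r) b$ act on \<open>V\<close>. The
  \<open>T m b\<close> commute with one another, so they generate a commutative algebra of operators that is
  stable under commutators with the Lie algebra. If \<open>f\<close> lies in any such algebra, the vectors killed
  by some power of \<open>f\<close> form a submodule; by irreducibility \<open>f\<close> is injective or locally nilpotent, and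
  in degree 0 local nilpotency is nilpotency because the dimensions of the weight spaces are bounded.

  Suppose \<open>T m 1 * T (- m) 1\<close> were nilpotent for some \<open>m \<noteq> 0\<close>. Nilpotent elements are preserved by
  derivations, and this spreads nilpotency to every \<open>T a 1\<close> with \<open>a \<noteq> 0\<close> (\<open>nil_T_all\<close>).
  Differentiating \<open>T s 1 ^ k = 0\<close> repeatedly shows that long products of operators \<open>T m b\<close> with \<open>m\<close>
  in an open half space vanish (\<open>power_T_mult_T_prod_eq_0\<close>), so all \<open>T m b\<close> with \<open>m \<noteq> 0\<close> have a
  common kernel vector; the common kernel is a submodule, so all of them vanish, which is
  excluded. Hence \<open>T m 1\<close> is injective for all \<open>m \<noteq> 0\<close>.

  With injective operators in every degree, the elements of degree 0 of a stable commutative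
  algebra that contains the \<open>T m 1\<close> are scalars (\<open>hom_0_scalar\<close>): after subtracting an eigenvalue
  they are nilpotent, and the common kernel of the homogeneous nilpotent elements is a nonzero
  submodule. It follows that \<open>T m b = chi b *\<^sub>C T m 1\<close> for \<open>m \<noteq> 0\<close>, with an algebra homomorphism
  \<open>chi\<close> from \<open>B\<close> to the complex numbers.

  If \<open>chi b = 0\<close>, the operators \<open>D u r b\<close> commute with all \<open>T m c\<close>, and they turn out to vanish for
  \<open>r \<noteq> 0\<close> (\<open>D_vanishing_of_chi\<close>). First, some power of \<open>b\<close> has this property, because
  \<open>ad (D v 0 b)\<close> multiplies \<open>D w s c\<close> by \<open>pairing v s\<close> times \<open>b\<close> and has only finitely many
  eigenvalues, the differences of those of \<open>D v 0 b\<close> on one weight space. Secondly, if \<open>b\<^sup>2\<close> has it,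
  then the \<open>T m c\<close> and \<open>D w r (c * b)\<close> generate a stable commutative algebra; its elements
  \<open>D v 0 (c * b)\<close> are scalars, and commuting them with \<open>D w r 1\<close> gives \<open>D w r (c * b) = 0\<close>.
  Hence \<open>D u 0 b\<close> is central, thus a scalar, and in general
  \<open>D u 0 b = D u 0 (b - chi b *\<^sub>C 1) + chi b *\<^sub>C D u 0 1\<close>, where \<open>D u 0 1\<close> acts on \<open>V\<^sub>\<Lambda>\<close> by the weight.
\<close>

section \<open>The algebra of linear endomorphisms\<close>

text \<open>Linear endomorphisms with composition as multiplication. The classes stop short of
  \<^class>\<open>ring_1\<close>, which would require \<open>0 \<noteq> 1\<close> and thus exclude the zero space.\<close>

typedef (overloaded) 'v endo = "{f :: 'v::complex_vector \<Rightarrow> 'v. clinear f}"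
  morphisms app Endo
  by (rule exI[of _ "\<lambda>x. x"]) (auto intro: clinearI)

setup_lifting type_definition_endo

instantiation endo :: (complex_vector) complex_vector
begin
lift_definition zero_endo :: "'a endo" is "\<lambda>x. 0" by (rule clinearI) simp_all
lift_definition plus_endo :: "'a endo \<Rightarrow> 'a endo \<Rightarrow> 'a endo" is "\<lambda>f g x. f x + g x"
  by (rule clinearI) (simp_all add: clinear_add clinear_scale scaleC_add_right)
lift_definition minus_endo :: "'a endo \<Rightarrow> 'a endo \<Rightarrow> 'a endo" is "\<lambda>f g x. f x - g x"
  by (rule clinearI) (simp_all add: clinear_add clinear_scale complex_vector.scale_right_diff_distrib)
lift_definition uminus_endo :: "'a endo \<Rightarrow> 'a endo" is "\<lambda>f x. - f x"
  by (rule clinearI) (simp_all add: clinear_add clinear_scale)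
lift_definition scaleC_endo :: "complex \<Rightarrow> 'a endo \<Rightarrow> 'a endo" is "\<lambda>c f x. c *\<^sub>C f x"
  by (rule clinearI) (simp_all add: clinear_add clinear_scale scaleC_add_right mult.commute)
instance
  by standard (transfer; simp add: fun_eq_iff add_ac scaleC_add_right scaleC_add_left scaleC_scaleC scaleC_one)+
end

instantiation endo :: (complex_vector) "{ring, monoid_mult}"
begin
lift_definition one_endo :: "'a endo" is "\<lambda>x. x" by (rule clinearI) simp_all
lift_definition times_endo :: "'a endo \<Rightarrow> 'a endo \<Rightarrow> 'a endo" is "\<lambda>f g x. f (g x)"
  by (rule clinearI) (simp_all add: clinear_add clinear_scale)
instance
  by standard (transfer; simp add: fun_eq_iff clinear_add clinear_0)+
end

lemma app_simps [simp]:
  "app 0 x = 0" "app 1 x = x" "app (f + g) x = app f x + app g x" "app (f - g) x = app f x - app g x"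
  "app (- f) x = - app f x" "app (c *\<^sub>C f) x = c *\<^sub>C app f x" "app (f * g) x = app f (app g x)"
  by (transfer; simp)+

lemma clinear_app: "clinear (app f)"
  using app by blast

lemma app_linear [simp]:
  "app f 0 = 0" "app f (x + y) = app f x + app f y" "app f (x - y) = app f x - app f y"
  "app f (- x) = - app f x" "app f (c *\<^sub>C x) = c *\<^sub>C app f x"
  using clinear_app[of f] by (simp_all add: clinear_0 clinear_add clinear_diff clinear_minus clinear_scale)

lemma endo_eqI: "(\<And>x. app f x = app g x) \<Longrightarrow> f = g"
  by (simp add: app_inject[symmetric] fun_eq_iff)

lemma scaleC_mult [simp]:
  fixes f g :: "'v::complex_vector endo"
  shows "(c *\<^sub>C f) * g = c *\<^sub>C (f * g)" "f * (c *\<^sub>C g) = c *\<^sub>C (f * g)"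
  by (auto intro: endo_eqI)

lemma inj_app_iff: "inj (app f) \<longleftrightarrow> (\<forall>v. app f v = 0 \<longrightarrow> v = 0)"
proof
  assume "inj (app f)"
  then show "\<forall>v. app f v = 0 \<longrightarrow> v = 0" using app_linear(1)[of f] by (metis injD)
next
  assume *: "\<forall>v. app f v = 0 \<longrightarrow> v = 0"
  show "inj (app f)"
  proof (rule injI)
    fix x y assume "app f x = app f y"
    then have "app f (x - y) = 0" by simp
    with * show "x = y" by (metis eq_iff_diff_eq_0)
  qed
qed

text \<open>The commutator of two endomorphisms.\<close>

definition br :: "'v::complex_vector endo \<Rightarrow> 'v endo \<Rightarrow> 'v endo" where
  "br x f = x * f - f * x"

lemma br_simps:
  "br x (f + g) = br x f + br x g" "br x (c *\<^sub>C f) = c *\<^sub>C br x f"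
  "br x (f * g) = br x f * g + f * br x g" "br x 1 = 0" "br x 0 = 0"
  by (simp_all add: br_def algebra_simps complex_vector.scale_right_diff_distrib)

lemma br_eq_0_iff: "br x f = 0 \<longleftrightarrow> x * f = f * x"
  by (simp add: br_def)

lemma mult_eq_br: "f * x = x * f - br x f"
  by (simp add: br_def)

lemma power_commute:
  fixes f g :: "'a::monoid_mult"
  assumes "f * g = g * f"
  shows "f ^ n * g = g * f ^ n"
  by (induction n) (simp_all add: assms mult.assoc, metis assms mult.assoc)

lemma br_power:
  assumes "f * br x f = br x f * f"
  shows "br x (f ^ Suc k) = of_nat (Suc k) *\<^sub>C (f ^ k * br x f)"
proof (induction k)
  case (Suc k)
  have "br x (f ^ Suc (Suc k)) = br x f * f ^ Suc k + f * br x (f ^ Suc k)"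
    by (simp add: br_simps)
  also have "br x f * f ^ Suc k = f ^ Suc k * br x f"
    using power_commute[OF assms, of "Suc k"] by metis
  also have "f * br x (f ^ Suc k) = of_nat (Suc k) *\<^sub>C (f ^ Suc k * br x f)"
    unfolding Suc by (simp add: mult.assoc)
  finally show ?case 
    by (metis (no_types, lifting) of_nat_Suc scaleC_add_left scaleC_one)
qed (simp add: br_simps)

lemma br_power_mult:
  assumes "f * br x f = br x f * f"
  shows "br x (f ^ k) * f = of_nat k *\<^sub>C (f ^ k * br x f)"
proof (cases k)
  case (Suc i)
  have "f ^ i * br x f * f = f ^ Suc i * br x f"
    using assms by (metis mult.assoc power_Suc2)
  then show ?thesis unfolding Suc br_power[OF assms] by simp
qed (simp add: br_simps)


section \<open>Nilpotent endomorphisms\<close>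

text \<open>Nilpotency, with one exponent for the whole space.\<close>

definition nil :: "'v::complex_vector endo \<Rightarrow> bool" where
  "nil f \<longleftrightarrow> (\<exists>n. f ^ n = 0)"

lemma nil_mult:
  assumes "nil f" "f * g = g * f"
  shows "nil (f * g)" "nil (g * f)"
proof -
  obtain n where n: "f ^ n = 0" using assms(1) by (auto simp: nil_def)
  have "(f * g) ^ k = f ^ k * g ^ k" for k
  proof (induction k)
    case (Suc k)
    have "f * g * (f ^ k * g ^ k) = f * (g * f ^ k) * g ^ k" by (simp add: mult.assoc)
    also have "g * f ^ k = f ^ k * g" using power_commute[OF assms(2)] by simp
    finally show ?case by (simp add: Suc mult.assoc)
  qed simp
  then have "(f * g) ^ n = 0" by (simp add: n)
  then show "nil (f * g)" "nil (g * f)" using assms(2) by (auto simp: nil_def)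
qed

lemma nil_power: "nil (f ^ k) \<Longrightarrow> nil f"
  unfolding nil_def by (metis power_mult)

lemma nil_scale_iff: "c \<noteq> 0 \<Longrightarrow> nil (c *\<^sub>C f) \<longleftrightarrow> nil f"
proof -
  assume c: "c \<noteq> 0"
  have "(c *\<^sub>C f) ^ n = (c ^ n) *\<^sub>C (f ^ n)" for n
    by (induction n) (simp_all add: mult.commute)
  then show ?thesis using c by (simp add: nil_def)
qed

lemma nil_add:
  assumes "nil f" "nil g" "f * g = g * f"
  shows "nil (f + g)"
proof -
  obtain m n where mn: "f ^ m = 0" "g ^ n = 0" using assms(1,2) by (auto simp: nil_def)
  have vanish: "f ^ i = 0" if "i \<ge> m" for i
    using mn(1) that by (metis le_Suc_ex mult_zero_left power_add)
  have vanish': "g ^ i = 0" if "i \<ge> n" for i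
    using mn(2) that by (metis le_Suc_ex mult_zero_left power_add)
  have "(f + g) ^ k * (f ^ i * g ^ j) = 0" if "k + i + j \<ge> m + n" for k i j
    using that
    \<comment> \<open>Each factor \<open>f + g\<close> raises the exponent of \<open>f\<close> or of \<open>g\<close>.\<close>
  proof (induction k arbitrary: i j)
    case 0
    then have "i \<ge> m \<or> j \<ge> n" by linarith
    then show ?case using vanish vanish' by auto
  next
    case (Suc k)
    have "(f + g) * (f ^ i * g ^ j) = f ^ Suc i * g ^ j + f ^ i * g ^ Suc j"
      using power_commute[OF assms(3), of i] by (simp add: algebra_simps flip: mult.assoc)
    moreover have "(f + g) ^ Suc k * (f ^ i * g ^ j) = (f + g) ^ k * ((f + g) * (f ^ i * g ^ j))"
      by (simp only: power_Suc2 mult.assoc)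
    ultimately have "(f + g) ^ Suc k * (f ^ i * g ^ j)
        = (f + g) ^ k * (f ^ Suc i * g ^ j) + (f + g) ^ k * (f ^ i * g ^ Suc j)"
      by (simp only: distrib_left)
    also have "\<dots> = 0"
      using Suc.IH[of "Suc i" j] Suc.IH[of i "Suc j"] Suc.prems by simp
    finally show ?case .
  qed
  from this[of "m + n" 0 0] show ?thesis by (auto simp: nil_def)
qed

lemma nil_diff:
  assumes "nil (f - g)" "nil f" "f * g = g * f"
  shows "nil g"
proof -
  have "nil (f + (-1) *\<^sub>C (f - g))"
  proof (rule nil_add)
    show "nil f" by fact
    show "nil ((-1) *\<^sub>C (f - g))" using assms(1) nil_scale_iff[of "-1" "f - g"] by simp
    show "f * ((-1) *\<^sub>C (f - g)) = (-1) *\<^sub>C (f - g) * f"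
      by (simp only: scaleC_mult right_diff_distrib left_diff_distrib assms(3))
  qed
  moreover have "f + (-1) *\<^sub>C (f - g) = g" by (rule endo_eqI) simp
  ultimately show ?thesis by simp
qed

text \<open>In characteristic zero, derivations preserve nilpotency: if \<open>\<delta>\<close> is the derivation
  \<open>br x\<close>, then $f^{k+1} \delta(f)^i = 0$ implies $f^k \delta(f)^{i+2} = 0$.\<close>

lemma nil_br:
  assumes "nil f" and c1: "f * br x f = br x f * f" and c2: "br x f * br x (br x f) = br x (br x f) * br x f"
  shows "nil (br x f)"
proof -
  define d where "d = br x f"
  have cd: "f * d = d * f" "d * br x d = br x d * d" using c1 c2 by (simp_all add: d_def)
  have step: "f ^ k * d ^ (i + 2) = 0" if "f ^ Suc k * d ^ i = 0" for k i
  proof -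
    have "br x (f ^ Suc k * d ^ i) * d = 0" unfolding that by (simp add: br_simps)
    then have "br x (f ^ Suc k) * d ^ i * d + f ^ Suc k * (br x (d ^ i) * d) = 0"
      by (simp only: br_simps distrib_right mult.assoc)
    moreover have "f ^ Suc k * (br x (d ^ i) * d) = 0"
      unfolding br_power_mult[OF cd(2)] using that by (metis complex_vector.scale_zero_right mult.assoc mult_zero_left scaleC_mult(2))
    ultimately have "of_nat (Suc k) *\<^sub>C (f ^ k * d) * d ^ i * d = 0"
      using br_power[of f x k] c1 by (simp add: d_def)
    then have "of_nat (Suc k) *\<^sub>C (f ^ k * (d * d ^ i * d)) = 0"
      by (simp add: mult.assoc)
    moreover have "d * d ^ i * d = d ^ (i + 2)"
      by (simp add: power_commutes mult.assoc)
    ultimately show ?thesis by (simp del: of_nat_Suc)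
  qed
  obtain n where n: "f ^ n = 0" using assms(1) by (auto simp: nil_def)
  have "f ^ (n - j) * d ^ (2 * j) = 0" if "j \<le> n" for j
    using that
  proof (induction j)
    case (Suc j)
    then have "f ^ Suc (n - Suc j) * d ^ (2 * j) = 0" by (simp add: Suc_diff_Suc del: power_Suc)
    from step[OF this] show ?case by simp
  qed (simp add: n)
  from this[of n] show ?thesis by (auto simp: nil_def d_def)
qed


section \<open>Endomorphisms of finite-dimensional subspaces\<close>

text \<open>A dimension bound that entails finite-dimensionality, unlike \<open>dim\<close>, which is 0 on
  infinite-dimensional spaces.\<close>

definition dim_bound :: "'v::complex_vector set \<Rightarrow> nat \<Rightarrow> bool" where
  "dim_bound U d \<longleftrightarrow> (\<forall>B\<subseteq>U. \<not> complex_vector.dependent B \<longrightarrow> finite B \<and> card B \<le> d)"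

lemma dim_boundI:
  assumes "finite S" "U \<subseteq> complex_vector.span S" "complex_vector.dim U \<le> d"
  shows "dim_bound U d"
  unfolding dim_bound_def
proof (intro allI impI)
  fix B assume B: "B \<subseteq> U" "\<not> complex_vector.dependent B"
  obtain C where C: "B \<subseteq> C" "C \<subseteq> U" "\<not> complex_vector.dependent C" "U \<subseteq> complex_vector.span C"
    using complex_vector.maximal_independent_subset_extend[OF B] by blast
  have "finite C"
    using complex_vector.independent_span_bound[OF assms(1) C(3)] C(2) assms(2) by auto
  moreover have "complex_vector.dim U = card C"
    using complex_vector.basis_card_eq_dim[OF C(2,4,3)] by simp
  ultimately show "finite B \<and> card B \<le> d"
    using C(1) assms(3) by (metis card_mono finite_subset le_trans)
qed

lemma dim_bound_0D:
  assumes "dim_bound U 0" "v \<in> U"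
  shows "v = 0"
proof (rule ccontr)
  assume "v \<noteq> 0"
  then have "\<not> complex_vector.dependent {v}" by simp
  then show False using assms by (auto simp: dim_bound_def dest!: spec[of _ "{v}"])
qed

lemma subspace_app_image: "complex_vector.subspace U \<Longrightarrow> complex_vector.subspace (app s ` U)"
proof -
  assume U: "complex_vector.subspace U"
  show ?thesis
  proof (rule complex_vector.subspaceI)
    show "0 \<in> app s ` U" using complex_vector.subspace_0[OF U] by (metis app_linear(1) imageI)
    fix x y c assume "x \<in> app s ` U"
    then obtain a where a: "a \<in> U" "x = app s a" by blast
    show "c *\<^sub>C x \<in> app s ` U"
      using complex_vector.subspace_scale[OF U a(1), of c] a(2) by (metis app_linear(5) imageI)
    assume "y \<in> app s ` U"
    then obtain b where b: "b \<in> U" "y = app s b" by blast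
    show "x + y \<in> app s ` U"
      using complex_vector.subspace_add[OF U a(1) b(1)] a(2) b(2) by (metis app_linear(2) imageI)
  qed
qed

text \<open>An endomorphism with nonzero kernel on \<open>U\<close> lowers the dimension bound; this drives all
  inductions on dimension below.\<close>

lemma dim_bound_image:
  assumes U: "complex_vector.subspace U" "dim_bound U (Suc d)"
    and u: "u \<in> U" "u \<noteq> 0" "app s u = 0"
  shows "dim_bound (app s ` U) d"
  unfolding dim_bound_def
proof (intro allI impI)
  interpret vector_space_pair "scaleC :: complex \<Rightarrow> 'a \<Rightarrow> 'a" "scaleC :: complex \<Rightarrow> 'a \<Rightarrow> 'a"
    by unfold_locales
  fix C assume C: "C \<subseteq> app s ` U" "\<not> complex_vector.dependent C"
  have "\<forall>c\<in>C. \<exists>a. a \<in> U \<and> app s a = c" using C(1) by auto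
  then obtain g where g: "\<And>c. c \<in> C \<Longrightarrow> g c \<in> U \<and> app s (g c) = c" by metis
  obtain h where h: "clinear h" "\<And>c. c \<in> C \<Longrightarrow> h c = g c"
    using linear_independent_extend[OF C(2)] by blast
  have lin: "clinear (\<lambda>x. app s (h x))"
    using h(1) by (intro clinearI) (simp_all add: clinear_add clinear_scale)
  have sh: "app s (h x) = x" if "x \<in> complex_vector.span C" for x
    by (rule linear_eq_on_span[OF lin _ _ that, of "\<lambda>x. x"]) (auto intro!: clinearI simp: g h(2))
  then have inj: "inj_on h (complex_vector.span C)" by (metis inj_onI)
  then have injC: "inj_on h C" using complex_vector.span_superset by (rule inj_on_subset)
  have "\<not> complex_vector.dependent (h ` C)"
    by (rule linear_independent_injective_image[OF h(1) C(2) inj])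
  moreover have "u \<notin> complex_vector.span (h ` C)"
  proof
    assume "u \<in> complex_vector.span (h ` C)"
    then obtain y where "y \<in> complex_vector.span C" "u = h y"
      by (auto simp: linear_span_image[OF h(1)])
    then show False using sh[of y] u clinear_0[OF h(1)] by auto
  qed
  ultimately have "\<not> complex_vector.dependent (insert u (h ` C))"
    by (simp add: complex_vector.independent_insert)
  moreover have "insert u (h ` C) \<subseteq> U" using u(1) g h(2) by auto
  ultimately have fin: "finite (insert u (h ` C))" "card (insert u (h ` C)) \<le> Suc d"
    using U(2)[unfolded dim_bound_def, rule_format, of "insert u (h ` C)"] by simp_all
  have "u \<notin> h ` C" using \<open>u \<notin> complex_vector.span (h ` C)\<close>
    by (rule contrapos_nn) (rule complex_vector.span_base)
  then have "finite (h ` C)" "card (h ` C) \<le> d" using fin by simp_all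
  then show "finite C \<and> card C \<le> d"
    using injC by (simp add: card_image finite_image_iff)
qed

lemma span_image_lessThanE:
  assumes "x \<in> complex_vector.span (f ` {..<m::nat})"
  obtains c where "x = (\<Sum>i<m. c i *\<^sub>C f i)"
proof -
  from assms have "\<exists>c. x = (\<Sum>i<m. c i *\<^sub>C f i)"
  proof (induction rule: complex_vector.span_induct_alt)
    case base
    show ?case by (rule exI[of _ "\<lambda>_. 0"]) simp
  next
    case (step a x y)
    then obtain c j where c: "y = (\<Sum>i<m. c i *\<^sub>C f i)" and j: "x = f j" "j < m" by auto
    have "(\<Sum>i<m. (c i + (if i = j then a else 0)) *\<^sub>C f i) = a *\<^sub>C x + y"
      using j by (simp add: scaleC_add_left sum.distrib c if_distrib[of "\<lambda>t. t *\<^sub>C _"] cong: if_cong)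
    then show ?case by (intro exI[of _ "\<lambda>i. c i + (if i = j then a else 0)"]) simp
  qed
  then show ?thesis using that by blast
qed

text \<open>The value of a polynomial at an endomorphism, applied to a vector.\<close>

definition poly_app :: "'v::complex_vector endo \<Rightarrow> complex poly \<Rightarrow> 'v \<Rightarrow> 'v" where
  "poly_app s p v = (\<Sum>i\<le>degree p. coeff p i *\<^sub>C app (s ^ i) v)"

lemma poly_app_le: "degree p \<le> n \<Longrightarrow> poly_app s p v = (\<Sum>i\<le>n. coeff p i *\<^sub>C app (s ^ i) v)"
  unfolding poly_app_def
  by (rule sum.mono_neutral_left) (auto simp: coeff_eq_0)

lemma poly_app_factor:
  "poly_app s ([:-a, 1:] * q) v = app s (poly_app s q v) - a *\<^sub>C poly_app s q v"
proof -
  let ?n = "degree q"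
  have sum_app: "app s (sum f A) = (\<Sum>i\<in>A. app s (f i))" for f :: "nat \<Rightarrow> 'a" and A
    using clinear_sum[OF clinear_app] .
  have "[:-a, 1:] * q = pCons 0 q - smult a q" by simp
  then have co: "coeff ([:-a, 1:] * q) i = (case i of 0 \<Rightarrow> 0 | Suc j \<Rightarrow> coeff q j) - a * coeff q i" for i
    by (simp only: coeff_diff coeff_smult coeff_pCons)
  have "degree ([:-a, 1:] * q) \<le> Suc ?n"
    by (rule order.trans[OF degree_mult_le]) simp
  then have "poly_app s ([:-a, 1:] * q) v = (\<Sum>i\<le>Suc ?n. coeff ([:-a, 1:] * q) i *\<^sub>C app (s ^ i) v)"
    by (rule poly_app_le)
  also have "\<dots> = (\<Sum>i\<le>Suc ?n. (case i of 0 \<Rightarrow> 0 | Suc j \<Rightarrow> coeff q j) *\<^sub>C app (s ^ i) v)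
      - (\<Sum>i\<le>Suc ?n. (a * coeff q i) *\<^sub>C app (s ^ i) v)"
    unfolding co by (simp only: complex_vector.scale_left_diff_distrib sum_subtractf)
  also have "(\<Sum>i\<le>Suc ?n. (case i of 0 \<Rightarrow> 0 | Suc j \<Rightarrow> coeff q j) *\<^sub>C app (s ^ i) v)
      = app s (poly_app s q v)"
    unfolding sum.atMost_Suc_shift poly_app_def by (simp add: sum_app)
  also have "(\<Sum>i\<le>Suc ?n. (a * coeff q i) *\<^sub>C app (s ^ i) v) = a *\<^sub>C poly_app s q v"
    by (simp add: poly_app_le[of q "Suc ?n"] complex_vector.scale_right_distrib complex_vector.scale_sum_right)
  finally show ?thesis .
qed

lemma app_power_mem:
  assumes "\<And>x. x \<in> U \<Longrightarrow> app s x \<in> U" "v \<in> U"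
  shows "app (s ^ i) v \<in> U"
  by (induction i) (simp_all add: assms)

lemma eigenvector_of_poly:
  assumes U: "complex_vector.subspace U" "\<And>x. x \<in> U \<Longrightarrow> app s x \<in> U"
    and v: "v \<in> U" "v \<noteq> 0" and p: "p \<noteq> 0" "poly_app s p v = 0"
  shows "\<exists>\<beta>. \<exists>w\<in>U. w \<noteq> 0 \<and> app s w = \<beta> *\<^sub>C w"
  using p
proof (induction "degree p" arbitrary: p rule: less_induct)
  case less
  show ?case
  proof (cases "degree p = 0")
    case True
    then obtain c where "p = [:c:]" by (auto dest: degree_eq_zeroE)
    then have "c *\<^sub>C v = 0" "c \<noteq> 0" using less.prems by (auto simp: poly_app_def)
    then show ?thesis using v(2) by simp
  next
    case False
    then have "\<not> constant (poly p)" by (simp add: constant_degree)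
    then obtain a where "poly p a = 0" using fundamental_theorem_of_algebra by blast
    then obtain q where q: "p = [:-a, 1:] * q" by (auto simp: poly_eq_0_iff_dvd elim: dvdE)
    then have q0: "q \<noteq> 0" using less.prems(1) by auto
    have deg: "degree q < degree p"
      unfolding q by (subst degree_mult_eq) (use q0 in auto)
    let ?w = "poly_app s q v"
    have "?w \<in> U"
      unfolding poly_app_def
      by (intro complex_vector.subspace_sum complex_vector.subspace_scale U app_power_mem v)
    moreover have "app s ?w = a *\<^sub>C ?w" using less.prems(2) unfolding q poly_app_factor by simp
    ultimately show ?thesis using less.hyps[OF deg q0] by (cases "?w = 0") auto
  qed
qed

lemma eigenvector_exists:
  assumes U: "complex_vector.subspace U" "\<And>x. x \<in> U \<Longrightarrow> app s x \<in> U" "dim_bound U d"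
    and v: "v \<in> U" "v \<noteq> 0"
  shows "\<exists>\<beta>. \<exists>w\<in>U. w \<noteq> 0 \<and> app s w = \<beta> *\<^sub>C w"
proof -
  let ?f = "\<lambda>i. app (s ^ i) v"
  have "\<exists>m. ?f m \<in> complex_vector.span (?f ` {..<m})"
  proof (rule ccontr)
    assume neg: "\<not> ?thesis"
    have "\<not> complex_vector.dependent (?f ` {..<k}) \<and> card (?f ` {..<k}) = k" for k
    proof (induction k)
      case (Suc k)
      have "?f k \<notin> complex_vector.span (?f ` {..<k})" using neg by blast
      moreover from this have "?f k \<notin> ?f ` {..<k}"
        by (rule contrapos_nn) (rule complex_vector.span_base)
      ultimately show ?case
        using Suc by (simp add: lessThan_Suc complex_vector.independent_insert)
    qed (simp add: complex_vector.independent_empty)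
    from this[of "Suc d"] have "\<not> complex_vector.dependent (?f ` {..<Suc d})" "card (?f ` {..<Suc d}) = Suc d"
      by auto
    moreover have "?f ` {..<Suc d} \<subseteq> U" using app_power_mem[OF U(2) v(1)] by auto
    ultimately show False
      using U(3)[unfolded dim_bound_def, rule_format, of "?f ` {..<Suc d}"] by linarith
  qed
  then obtain m where "?f m \<in> complex_vector.span (?f ` {..<m})" by blast
  then obtain c where c: "?f m = (\<Sum>i<m. c i *\<^sub>C ?f i)" by (rule span_image_lessThanE)
  define p where "p = monom 1 m - (\<Sum>i<m. monom (c i) i)"
  have co: "coeff p i = (if i = m then 1 else if i < m then - c i else 0)" for i
    by (simp add: p_def coeff_sum sum.delta)
  have "degree p \<le> m" by (rule degree_le) (simp add: co)
  then have "poly_app s p v = (\<Sum>i\<le>m. coeff p i *\<^sub>C ?f i)" by (rule poly_app_le)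
  also have "\<dots> = ?f m - (\<Sum>i<m. c i *\<^sub>C ?f i)"
    by (simp add: lessThan_Suc_atMost[symmetric] co sum_negf)
  finally have "poly_app s p v = 0" using c by simp
  moreover have "p \<noteq> 0" using co[of m] by auto
  ultimately show ?thesis using eigenvector_of_poly[OF U(1,2) v] by blast
qed

text \<open>The product of the linear factors \<open>s - \<beta>\<close>, in list order.\<close>

definition lin_prod :: "'v::complex_vector endo \<Rightarrow> complex list \<Rightarrow> 'v endo" where
  "lin_prod s \<beta>s = prod_list (map (\<lambda>\<beta>. s - \<beta> *\<^sub>C 1) \<beta>s)"

lemma lin_prod_simps [simp]:
  "lin_prod s [] = 1" "lin_prod s (\<beta> # \<beta>s) = (s - \<beta> *\<^sub>C 1) * lin_prod s \<beta>s"
  "lin_prod s (as @ bs) = lin_prod s as * lin_prod s bs"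
  by (simp_all add: lin_prod_def)

text \<open>A weak form of the Cayley--Hamilton theorem.\<close>

lemma annihilating_lin_prod:
  assumes "complex_vector.subspace U" "\<And>x. x \<in> U \<Longrightarrow> app s x \<in> U" "dim_bound U d"
  shows "\<exists>\<beta>s. \<forall>v\<in>U. app (lin_prod s \<beta>s) v = 0"
  using assms
proof (induction d arbitrary: U)
  case 0
  then show ?case by (intro exI[of _ "[]"]) (auto dest: dim_bound_0D)
next
  case (Suc d)
  show ?case
  proof (cases "\<exists>v\<in>U. v \<noteq> 0")
    case False
    then show ?thesis by (intro exI[of _ "[]"]) auto
  next
    case True
    then obtain \<beta> w where w: "w \<in> U" "w \<noteq> 0" "app s w = \<beta> *\<^sub>C w"
      using eigenvector_exists[OF Suc.prems] by blast
    let ?t = "s - \<beta> *\<^sub>C 1"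
    have "\<exists>\<beta>s. \<forall>v\<in>app ?t ` U. app (lin_prod s \<beta>s) v = 0"
    proof (rule Suc.IH)
      show "complex_vector.subspace (app ?t ` U)" by (rule subspace_app_image[OF Suc.prems(1)])
      show "dim_bound (app ?t ` U) d"
        by (rule dim_bound_image[OF Suc.prems(1,3) w(1,2)]) (simp add: w(3))
      fix x assume "x \<in> app ?t ` U"
      then obtain y where "y \<in> U" "x = app ?t y" by blast
      then show "app s x \<in> app ?t ` U" using Suc.prems(2)[of y] by (intro image_eqI[of _ _ "app s y"]) auto
    qed
    then obtain \<beta>s where "\<forall>v\<in>app ?t ` U. app (lin_prod s \<beta>s) v = 0" by blast
    then show ?thesis by (intro exI[of _ "\<beta>s @ [\<beta>]"]) simp
  qed
qed

text \<open>A form of Engel's theorem for commuting operators.\<close>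

lemma prod_list_nilpotent_eq_0:
  assumes "complex_vector.subspace W" "dim_bound W (length xs)" "set xs \<subseteq> S"
    and comm: "\<And>f g. f \<in> S \<Longrightarrow> g \<in> S \<Longrightarrow> f * g = g * f"
    and "\<And>f v. f \<in> S \<Longrightarrow> v \<in> W \<Longrightarrow> app f v \<in> W"
    and "\<And>f v. f \<in> S \<Longrightarrow> v \<in> W \<Longrightarrow> \<exists>n. app (f ^ n) v = 0"
    and "v \<in> W"
  shows "app (prod_list xs) v = 0"
  using assms(1,2,3,5-)
proof (induction xs arbitrary: W v rule: rev_induct)
  case Nil
  then show ?case by (auto dest: dim_bound_0D)
next
  case (snoc s xs)
  show ?case
  proof (cases "\<exists>v\<in>W. v \<noteq> 0")
    case True
    then obtain x where x: "x \<in> W" "x \<noteq> 0" by blast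
    have s: "s \<in> S" using snoc.prems by simp
    define n where "n = (LEAST n. app (s ^ n) x = 0)"
    have n: "app (s ^ n) x = 0" unfolding n_def using snoc.prems(5)[OF s x(1)] by (rule LeastI_ex)
    then have "n \<noteq> 0" using x by (cases n) auto
    then obtain k where k: "n = Suc k" by (cases n) auto
    have "app (s ^ k) x \<noteq> 0" using not_less_Least[of k "\<lambda>n. app (s ^ n) x = 0"] k n_def by auto
    moreover have "app (s ^ k) x \<in> W" by (rule app_power_mem[OF snoc.prems(4)[OF s] x(1)])
    moreover have "app s (app (s ^ k) x) = 0" using n k by simp
    ultimately have dim: "dim_bound (app s ` W) (length xs)"
      using dim_bound_image[of W "length xs"] snoc.prems(1,2) by auto
    have "app (prod_list xs) (app s v) = 0"
    proof (rule snoc.IH[OF _ dim])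
      show "complex_vector.subspace (app s ` W)" using snoc.prems(1) by (rule subspace_app_image)
      show "set xs \<subseteq> S" using snoc.prems(3) by simp
      show "app s v \<in> app s ` W" using snoc.prems by simp
      fix f y assume f: "f \<in> S" and "y \<in> app s ` W"
      then obtain z where z: "z \<in> W" "y = app s z" by blast
      have "app f y = app s (app f z)" using comm[OF f s] z(2) by (metis app_simps(7))
      then show "app f y \<in> app s ` W" using snoc.prems(4)[OF f z(1)] by simp
      show "\<exists>n. app (f ^ n) y = 0" using snoc.prems(5)[OF f] snoc.prems(4)[OF s] z by blast
    qed
    then show ?thesis by simp
  qed (use snoc.prems in auto)
qed

text \<open>A product of maximal length that does not kill \<open>v\<close> maps \<open>v\<close> into the common kernel.\<close>

lemma common_kernel_of_products:
  assumes "v \<noteq> 0" "\<And>xs. set xs \<subseteq> S \<Longrightarrow> length xs = k \<Longrightarrow> app (prod_list xs) v = 0"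
  shows "\<exists>xs. set xs \<subseteq> S \<and> app (prod_list xs) v \<noteq> 0 \<and> (\<forall>f\<in>S. app f (app (prod_list xs) v) = 0)"
  using assms(2)
proof (induction k)
  case 0
  from "0.prems"[of "[]"] show ?case using assms(1) by simp
next
  case (Suc k)
  show ?case
  proof (cases "\<exists>xs. set xs \<subseteq> S \<and> length xs = k \<and> app (prod_list xs) v \<noteq> 0")
    case True
    then obtain xs where xs: "set xs \<subseteq> S" "length xs = k" "app (prod_list xs) v \<noteq> 0" by blast
    have "app f (app (prod_list xs) v) = 0" if "f \<in> S" for f
      using Suc.prems[of "f # xs"] xs that by simp
    then show ?thesis using xs by blast
  next
    case False
    then show ?thesis using Suc.IH by blast
  qed
qed


section \<open>Parallel integer vectors\<close>

text \<open>Linear dependence, expressed by the vanishing of all \<open>2 \<times> 2\<close> minors; the zero vector is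
  parallel to everything.\<close>

definition par :: "int ^ 'n \<Rightarrow> int ^ 'n \<Rightarrow> bool" where
  "par r m \<longleftrightarrow> (\<forall>i j. r $ i * m $ j = r $ j * m $ i)"

lemma par_commute: "par r m \<longleftrightarrow> par m r"
  unfolding par_def by (metis mult.commute)

lemma par_add_iff: "par r (m + r) \<longleftrightarrow> par r m"
  by (simp add: par_def algebra_simps)

lemma par_diff_iff: "par r (m - r) \<longleftrightarrow> par r m" "par r (r - m) \<longleftrightarrow> par r m"
  by (auto simp: par_def algebra_simps)

lemma par_trans:
  assumes "par n m" "par m a" "m \<noteq> 0"
  shows "par n a"
proof -
  obtain k where k: "m $ k \<noteq> 0" using assms(3) by (auto simp: vec_eq_iff)
  show ?thesis
    unfolding par_def
  proof (intro allI)
    fix i j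
    have n: "n $ i * m $ k = n $ k * m $ i" for i using assms(1) by (simp add: par_def)
    have a: "m $ k * a $ j = m $ j * a $ k" for j using assms(2) by (simp add: par_def)
    have "(n $ i * a $ j) * (m $ k * m $ k) = (n $ i * m $ k) * (m $ k * a $ j)" by (simp add: ac_simps)
    also have "\<dots> = (n $ k * m $ i) * (m $ j * a $ k)" by (simp only: n a)
    also have "\<dots> = (n $ k * m $ j) * (m $ i * a $ k)" by (simp add: ac_simps)
    also have "\<dots> = (n $ j * m $ k) * (m $ k * a $ i)" by (simp only: n a)
    also have "\<dots> = (n $ j * a $ i) * (m $ k * m $ k)" by (simp add: ac_simps)
    finally show "n $ i * a $ j = n $ j * a $ i" using k by simp
  qed
qed

lemma ex_other_index:
  assumes "CARD('n::finite) \<ge> 2"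
  shows "\<exists>j :: 'n. j \<noteq> i"
proof (rule ccontr)
  assume "\<not> ?thesis"
  then have "UNIV = {i}" by auto
  then have "CARD('n) = card {i}" by (rule arg_cong)
  then show False using assms by simp
qed

lemma ex_not_par:
  fixes m :: "int ^ 'n::finite"
  assumes "m \<noteq> 0" "CARD('n) \<ge> 2"
  shows "\<exists>n. \<not> par m n"
proof -
  obtain i where i: "m $ i \<noteq> 0" using assms(1) by (auto simp: vec_eq_iff)
  obtain j where "j \<noteq> i" using ex_other_index[OF assms(2)] by blast
  then have "m $ i * axis j 1 $ j \<noteq> m $ j * axis j 1 $ i" using i by (simp add: axis_def)
  then show ?thesis unfolding par_def by blast
qed

lemma pairing_axis [simp]: "pairing (axis i 1) m = of_int (m $ i)"
  unfolding pairing_def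
  by (subst sum.cong[OF refl, of _ _ "\<lambda>k. if k = i then of_int (m $ k) else 0"]) (auto simp: axis_def)

lemma pairing_minus [simp]: "pairing u (- m) = - pairing u m"
  by (simp add: pairing_def sum_negf)

lemma pairing_diff: "pairing u (r - s) = pairing u r - pairing u s"
  using pairing_add[of u r "- s"] by simp

lemma pairing_scale [simp]: "pairing (c *\<^sub>C u) m = c * pairing u m"
  using pairing_bracket[of c u 0 0 m] by simp

lemma pairing_add_left: "pairing (u + v) m = pairing u m + pairing v m"
  using pairing_bracket[of 1 u "-1" v m] by simp

lemma not_par_functional:
  fixes r m :: "int ^ 'n::finite"
  assumes "\<not> par r m"
  shows "\<exists>u. pairing u r = 0 \<and> pairing u m = 1"
proof -
  obtain i j where ij: "r $ i * m $ j \<noteq> r $ j * m $ i" using assms by (auto simp: par_def)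
  define d :: complex where "d = of_int (r $ i * m $ j - r $ j * m $ i)"
  have d: "d \<noteq> 0" unfolding d_def using ij by (simp only: of_int_eq_0_iff)
  define u :: "complex ^ 'n" where "u = of_int (r $ i) *\<^sub>C axis j 1 - of_int (r $ j) *\<^sub>C axis i 1"
  have "pairing u r = 0" "pairing u m = d"
    by (simp_all add: u_def d_def pairing_bracket)
  then show ?thesis using d by (intro exI[of _ "inverse d *\<^sub>C u"]) simp
qed


section \<open>Algebras of commuting operators\<close>

text \<open>The unital subalgebra generated by a set of endomorphisms.\<close>

inductive_set gen_alg :: "'v::complex_vector endo set \<Rightarrow> 'v endo set" for G where
  gen_alg_one: "1 \<in> gen_alg G"
| gen_alg_base: "g \<in> G \<Longrightarrow> g \<in> gen_alg G"
| gen_alg_add: "f \<in> gen_alg G \<Longrightarrow> g \<in> gen_alg G \<Longrightarrow> f + g \<in> gen_alg G"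
| gen_alg_scale: "f \<in> gen_alg G \<Longrightarrow> c *\<^sub>C f \<in> gen_alg G"
| gen_alg_mult: "f \<in> gen_alg G \<Longrightarrow> g \<in> gen_alg G \<Longrightarrow> f * g \<in> gen_alg G"

lemma gen_alg_commute_with:
  assumes "f \<in> gen_alg G" "\<And>g. g \<in> G \<Longrightarrow> h * g = g * h"
  shows "h * f = f * h"
  using assms(1)
proof induction
  case (gen_alg_mult f g)
  then show ?case by (metis mult.assoc)
qed (simp_all add: assms(2) distrib_left distrib_right)

lemma gen_alg_commute:
  assumes "\<And>g h. g \<in> G \<Longrightarrow> h \<in> G \<Longrightarrow> g * h = h * g" "f \<in> gen_alg G" "g \<in> gen_alg G"
  shows "f * g = g * f"
  by (rule gen_alg_commute_with[OF assms(3)])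
    (metis gen_alg_commute_with[OF assms(2)] assms(1))

lemma gen_alg_br:
  assumes "f \<in> gen_alg G" "\<And>g. g \<in> G \<Longrightarrow> br x g \<in> gen_alg G"
  shows "br x f \<in> gen_alg G"
  using assms(1)
proof induction
  case gen_alg_one
  have "0 *\<^sub>C (1 :: 'a endo) \<in> gen_alg G" by (intro gen_alg.intros)
  then show ?case by (simp add: br_simps)
qed (auto simp: br_simps intro: gen_alg.intros assms(2))


section \<open>The operators of a uniformly bounded irreducible module\<close>

text \<open>
  \<open>T m b\<close> and \<open>D u r b\<close> are the actions of $t^m b$ and $D(u, r) b$; the latter is constrained only for
  \<open>pairing u r = 0\<close>. \<open>Lam\<close> is a set of weights, as functionals on $\mathbb{C}^N$, whose weight spaces
  span the module, and \<open>M\<close> bounds their dimensions. Nothing is assumed about \<open>T 0 b\<close> beyond the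
  commutation relations: it is central and independent of the other \<open>T m b\<close>.
\<close>

locale SA_operators =
  fixes T :: "int ^ 'n::finite \<Rightarrow> 'b::complex_comm_algebra_1 \<Rightarrow> 'v::complex_vector endo"
    and D :: "complex ^ 'n \<Rightarrow> int ^ 'n \<Rightarrow> 'b \<Rightarrow> 'v endo"
    and Lam :: "(complex ^ 'n \<Rightarrow> complex) set" and M :: nat
  assumes card: "CARD('n) \<ge> 2"
    and T_add: "T m (b + c) = T m b + T m c" and T_scale: "T m (k *\<^sub>C b) = k *\<^sub>C T m b"
    and D_add: "D u r (b + c) = D u r b + D u r c" and D_scale: "D u r (k *\<^sub>C b) = k *\<^sub>C D u r b"
    and D_scale_left: "pairing u r = 0 \<Longrightarrow> D (k *\<^sub>C u) r b = k *\<^sub>C D u r b"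
    and T_T: "T r b * T s c = T s c * T r b"
    and D_T: "pairing u r = 0 \<Longrightarrow> br (D u r b) (T s c) = pairing u s *\<^sub>C T (r + s) (b * c)"
    and D_D: "pairing u r = 0 \<Longrightarrow> pairing v s = 0 \<Longrightarrow>
      br (D u r b) (D v s c) = D (pairing u s *\<^sub>C v - pairing v r *\<^sub>C u) (r + s) (b * c)"
    and irreducible: "complex_vector.subspace U \<Longrightarrow>
      (\<And>u r b v. pairing u r = 0 \<Longrightarrow> v \<in> U \<Longrightarrow> app (D u r b) v \<in> U) \<Longrightarrow>
      (\<And>r b v. v \<in> U \<Longrightarrow> app (T r b) v \<in> U) \<Longrightarrow> U = {0} \<or> U = UNIV"
    and nontrivial: "\<exists>v :: 'v. v \<noteq> 0"
    and wt_dim: "\<mu> \<in> Lam \<Longrightarrow> dim_bound {v. \<forall>u. app (D u 0 1) v = \<mu> u *\<^sub>C v} M"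
    and wt_span: "complex_vector.span (\<Union>\<mu>\<in>Lam. {v. \<forall>u. app (D u 0 1) v = \<mu> u *\<^sub>C v}) = UNIV"
    and T_nonzero: "\<exists>s b. s \<noteq> 0 \<and> T s b \<noteq> 0"
begin

text \<open>The weight space of the weight \<open>\<mu>\<close>.\<close>

definition wt :: "(complex ^ 'n \<Rightarrow> complex) \<Rightarrow> 'v set" where
  "wt \<mu> = {v. \<forall>u. app (D u 0 1) v = \<mu> u *\<^sub>C v}"

text \<open>The operators by which the generators of the Lie algebra act.\<close>

definition Gen :: "'v endo set" where
  "Gen = {D u r b | u r b. pairing u r = 0} \<union> {T r b | r b. True}"

text \<open>Homogeneous operators of degree \<open>m\<close>, which shift weights by \<open>m\<close>.\<close>

definition hom :: "int ^ 'n \<Rightarrow> 'v endo \<Rightarrow> bool" where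
  "hom m f \<longleftrightarrow> (\<forall>u. br (D u 0 1) f = pairing u m *\<^sub>C f)"

lemma D_in_Gen: "pairing u r = 0 \<Longrightarrow> D u r b \<in> Gen" and T_in_Gen: "T r b \<in> Gen"
  by (auto simp: Gen_def)

lemma GenE:
  assumes "x \<in> Gen"
  obtains (D) u r b where "x = D u r b" "pairing u r = 0" | (T) r b where "x = T r b"
  using assms by (auto simp: Gen_def)

lemma stable_subspace_UNIV:
  assumes "complex_vector.subspace U" "\<And>x v. x \<in> Gen \<Longrightarrow> v \<in> U \<Longrightarrow> app x v \<in> U" "v \<in> U" "v \<noteq> 0"
  shows "U = UNIV"
  using irreducible[OF assms(1)] assms(2-) D_in_Gen T_in_Gen by blast

lemma subspace_wt: "complex_vector.subspace (wt \<mu>)"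
  by (rule complex_vector.subspaceI) (simp_all add: wt_def scaleC_add_right mult.commute)

lemma dim_bound_wt: "\<mu> \<in> Lam \<Longrightarrow> dim_bound (wt \<mu>) M"
  using wt_dim by (simp add: wt_def)

lemma endo_eq_0_on_wt:
  assumes "\<And>\<mu> v. \<mu> \<in> Lam \<Longrightarrow> v \<in> wt \<mu> \<Longrightarrow> app f v = 0"
  shows "f = 0"
proof (rule endo_eqI)
  fix x
  have "complex_vector.subspace {v. app f v = 0}"
    by (rule complex_vector.subspaceI) simp_all
  then have "complex_vector.span (\<Union>\<mu>\<in>Lam. wt \<mu>) \<subseteq> {v. app f v = 0}"
    using assms by (intro complex_vector.span_minimal) auto
  then show "app f x = app 0 x" using wt_span unfolding wt_def by auto
qed

lemma ex_weight: "\<exists>\<mu>\<in>Lam. \<exists>v\<in>wt \<mu>. v \<noteq> 0"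
proof (rule ccontr)
  assume "\<not> ?thesis"
  then have "(1 :: 'v endo) = 0" by (intro endo_eq_0_on_wt) auto
  then have "v = 0" for v :: 'v by (metis app_simps(1,2))
  with nontrivial show False by blast
qed

lemma hom_T: "hom m (T m b)"
  by (simp add: hom_def D_T)

lemma hom_D: "pairing u r = 0 \<Longrightarrow> hom r (D u r b)"
  by (simp add: hom_def D_D D_scale_left)

lemma hom_mult: "hom m f \<Longrightarrow> hom n g \<Longrightarrow> hom (m + n) (f * g)"
  by (simp add: hom_def br_simps pairing_add scaleC_add_left)

lemma hom_1: "hom 0 1"
  by (simp add: hom_def br_simps)

lemma hom_scale: "hom m f \<Longrightarrow> hom m (c *\<^sub>C f)"
  by (simp add: hom_def br_simps mult.commute)

lemma hom_diff: "hom m f \<Longrightarrow> hom m g \<Longrightarrow> hom m (f - g)"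
proof -
  have "br x (f - g) = br x f - br x g" for x by (simp add: br_def algebra_simps)
  then show "hom m f \<Longrightarrow> hom m g \<Longrightarrow> hom m (f - g)"
    by (simp add: hom_def complex_vector.scale_right_diff_distrib)
qed

lemma hom_br: "hom m x \<Longrightarrow> hom n f \<Longrightarrow> hom (m + n) (br x f)"
  unfolding br_def using hom_mult[of m x n f] hom_mult[of n f m x] by (simp add: hom_diff add.commute)

lemma hom_0_iff: "hom 0 f \<longleftrightarrow> (\<forall>u. D u 0 1 * f = f * D u 0 1)"
  by (simp add: hom_def br_eq_0_iff)

lemma Gen_hom: "x \<in> Gen \<Longrightarrow> \<exists>r. hom r x"
  by (auto elim!: GenE intro: hom_T hom_D)

lemma hom_wt:
  assumes "hom m f" "v \<in> wt \<mu>"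
  shows "app f v \<in> wt (\<lambda>u. \<mu> u + pairing u m)"
  unfolding wt_def
proof (intro CollectI allI)
  fix u
  have "D u 0 1 * f = f * D u 0 1 + pairing u m *\<^sub>C f"
    using assms(1) by (simp add: hom_def br_def algebra_simps)
  then have "app (D u 0 1 * f) v = app (f * D u 0 1 + pairing u m *\<^sub>C f) v" by simp
  then show "app (D u 0 1) (app f v) = (\<mu> u + pairing u m) *\<^sub>C app f v"
    using assms(2) by (simp add: wt_def scaleC_add_left)
qed

lemma hom_0_wt: "hom 0 f \<Longrightarrow> v \<in> wt \<mu> \<Longrightarrow> app f v \<in> wt \<mu>"
  using hom_wt[of 0 f v \<mu>] by simp

text \<open>Schur's lemma.\<close>

lemma central_scalar:
  assumes "\<And>x. x \<in> Gen \<Longrightarrow> x * f = f * x"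
  shows "\<exists>c. f = c *\<^sub>C 1"
proof -
  have "hom 0 f" using assms D_in_Gen by (simp add: hom_0_iff)
  obtain \<mu> v where v: "\<mu> \<in> Lam" "v \<in> wt \<mu>" "v \<noteq> 0" using ex_weight by blast
  obtain c w where w: "w \<noteq> 0" "app f w = c *\<^sub>C w"
    using eigenvector_exists[OF subspace_wt hom_0_wt[OF \<open>hom 0 f\<close>] dim_bound_wt[OF v(1)] v(2,3)] by blast
  have "{v. app f v = c *\<^sub>C v} = UNIV"
  proof (rule stable_subspace_UNIV)
    show "complex_vector.subspace {v. app f v = c *\<^sub>C v}"
      by (rule complex_vector.subspaceI) (simp_all add: scaleC_add_right mult.commute)
    show "w \<in> {v. app f v = c *\<^sub>C v}" "w \<noteq> 0" using w by auto
    fix x v assume x: "x \<in> Gen" and "v \<in> {v. app f v = c *\<^sub>C v}"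
    then show "app x v \<in> {v. app f v = c *\<^sub>C v}"
      using arg_cong[OF assms[OF x], of "\<lambda>h. app h v"] by simp
  qed
  then show ?thesis by (intro exI[of _ c] endo_eqI) auto
qed

text \<open>A commutative algebra of operators on which the Lie algebra acts by derivations.\<close>

definition stable_algebra :: "'v endo set \<Rightarrow> bool" where
  "stable_algebra P \<longleftrightarrow> 1 \<in> P \<and> (\<forall>f\<in>P. \<forall>g\<in>P. f + g \<in> P \<and> f * g \<in> P \<and> f * g = g * f)
     \<and> (\<forall>c. \<forall>f\<in>P. c *\<^sub>C f \<in> P) \<and> (\<forall>x\<in>Gen. \<forall>f\<in>P. br x f \<in> P)"

lemma stable_algebra_gen_alg:
  assumes "\<And>g h. g \<in> G \<Longrightarrow> h \<in> G \<Longrightarrow> g * h = h * g"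
    and "\<And>x g. x \<in> Gen \<Longrightarrow> g \<in> G \<Longrightarrow> br x g \<in> gen_alg G"
  shows "stable_algebra (gen_alg G)"
  unfolding stable_algebra_def
  using gen_alg_commute[OF assms(1)] gen_alg_br[OF _ assms(2)]
  by (auto intro: gen_alg.intros)

context
  fixes P assumes P: "stable_algebra P"
begin

lemma stable_algebra_closed:
  "1 \<in> P" "f \<in> P \<Longrightarrow> g \<in> P \<Longrightarrow> f + g \<in> P" "f \<in> P \<Longrightarrow> g \<in> P \<Longrightarrow> f * g \<in> P"
  "f \<in> P \<Longrightarrow> c *\<^sub>C f \<in> P" "x \<in> Gen \<Longrightarrow> f \<in> P \<Longrightarrow> br x f \<in> P"
  using P by (simp_all add: stable_algebra_def)

lemma stable_algebra_commute: "f \<in> P \<Longrightarrow> g \<in> P \<Longrightarrow> f * g = g * f"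
  using P by (simp add: stable_algebra_def)

lemma stable_algebra_diff: "f \<in> P \<Longrightarrow> g \<in> P \<Longrightarrow> f - g \<in> P"
  using stable_algebra_closed(2)[of f "(-1) *\<^sub>C g"] stable_algebra_closed(4)[of g "-1"] by simp

lemma nil_br_stable: "f \<in> P \<Longrightarrow> x \<in> Gen \<Longrightarrow> nil f \<Longrightarrow> nil (br x f)"
  by (rule nil_br) (simp_all add: stable_algebra_closed stable_algebra_commute)

text \<open>The vectors killed by a power of \<open>f\<close> form a submodule, since \<open>f\<close> commutes with \<open>br x f\<close>.\<close>

lemma inj_or_locally_nil:
  assumes f: "f \<in> P"
  shows "inj (app f) \<or> (\<forall>v. \<exists>n. app (f ^ n) v = 0)"
proof (cases "inj (app f)")
  case False
  then obtain w where w: "app f w = 0" "w \<noteq> 0" by (auto simp: inj_app_iff)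
  have mono: "app (f ^ n) v = 0" if "app (f ^ m) v = 0" "m \<le> n" for m n v
    using that by (metis app_linear(1) app_simps(7) le_add_diff_inverse2 power_add)
  have "{v. \<exists>n. app (f ^ n) v = 0} = UNIV"
  proof (rule stable_subspace_UNIV)
    show "complex_vector.subspace {v. \<exists>n. app (f ^ n) v = 0}"
    proof (rule complex_vector.subspaceI)
      fix x y assume "x \<in> {v. \<exists>n. app (f ^ n) v = 0}" "y \<in> {v. \<exists>n. app (f ^ n) v = 0}"
      then obtain m n where "app (f ^ m) x = 0" "app (f ^ n) y = 0" by blast
      then have "app (f ^ (m + n)) x = 0" "app (f ^ (m + n)) y = 0" using mono by auto
      then show "x + y \<in> {v. \<exists>n. app (f ^ n) v = 0}" by (intro CollectI exI[of _ "m + n"]) simp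
    qed auto
    show "w \<in> {v. \<exists>n. app (f ^ n) v = 0}" using w(1) by (auto intro: exI[of _ 1])
    show "w \<noteq> 0" by fact
    fix x v assume x: "x \<in> Gen" and "v \<in> {v. \<exists>n. app (f ^ n) v = 0}"
    then obtain n where n: "app (f ^ n) v = 0" by auto
    have c: "f * br x f = br x f * f"
      using f x by (simp add: stable_algebra_closed stable_algebra_commute)
    have "f ^ Suc n * x = x * f ^ Suc n - of_nat (Suc n) *\<^sub>C (br x f * f ^ n)"
      unfolding mult_eq_br[of "f ^ Suc n" x] br_power[OF c] power_commute[OF c] ..
    then have "app (f ^ Suc n * x) v = app (x * f ^ Suc n - of_nat (Suc n) *\<^sub>C (br x f * f ^ n)) v"
      by simp
    then have "app (f ^ Suc n) (app x v) = 0" by (simp add: n del: of_nat_Suc)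
    then show "app x v \<in> {v. \<exists>n. app (f ^ n) v = 0}" by blast
  qed
  then show ?thesis by blast
qed simp

lemma nil_of_not_inj:
  assumes f: "f \<in> P" "hom 0 f" "\<not> inj (app f)"
  shows "nil f"
proof -
  have "f ^ M = 0"
  proof (rule endo_eq_0_on_wt)
    fix \<mu> v assume "\<mu> \<in> Lam" "v \<in> wt \<mu>"
    then have "app (prod_list (replicate M f)) v = 0"
      using inj_or_locally_nil[OF f(1)] f(3) hom_0_wt[OF f(2)]
      by (intro prod_list_nilpotent_eq_0[OF subspace_wt, of \<mu> _ "{f}"]) (auto simp: dim_bound_wt)
    then show "app (f ^ M) v = 0" by simp
  qed
  then show ?thesis by (auto simp: nil_def)
qed

end

section \<open>The operators \<open>T m b\<close> with \<open>m \<noteq> 0\<close> are injective\<close>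

text \<open>The algebra generated by all \<open>T r b\<close>.\<close>

definition T_alg :: "'v endo set" where
  "T_alg = gen_alg {T r b | r b. True}"

lemma T_in_T_alg: "T r b \<in> T_alg"
  unfolding T_alg_def by (auto intro: gen_alg_base)

lemma stable_T_alg: "stable_algebra T_alg"
  unfolding T_alg_def
proof (rule stable_algebra_gen_alg)
  fix g h assume "g \<in> {T r b |r b. True}" "h \<in> {T r b |r b. True}"
  then show "g * h = h * g" using T_T by auto
next
  fix x g assume x: "x \<in> Gen" and "g \<in> {T r b |r b. True}"
  then obtain s c where g: "g = T s c" by blast
  from x show "br x g \<in> gen_alg {T r b |r b. True}"
  proof (cases rule: GenE)
    case (D u r b)
    then show ?thesis unfolding D g D_T[OF D(2)] by (auto intro: gen_alg_scale gen_alg_base)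
  next
    case (T r b)
    have "br x g = 0 *\<^sub>C 1" unfolding T g using T_T by (simp add: br_eq_0_iff)
    then show ?thesis by (simp only: gen_alg_scale gen_alg_one)
  qed
qed

lemmas T_alg_closed = stable_algebra_closed[OF stable_T_alg] T_in_T_alg
lemmas T_alg_commute = stable_algebra_commute[OF stable_T_alg]

lemma T_left_commute: "T r b * (T s c * h) = T s c * (T r b * h)"
  by (metis T_T mult.assoc)

text \<open>Differentiating \<open>T m 1 * T (- m) 1\<close> in direction \<open>n + m\<close> and multiplying by \<open>T m 1\<close> shows that
  \<open>(T m 1)\<^sup>2 * T n 1\<close> is nilpotent.\<close>

lemma nil_T_T_of_not_par:
  assumes "nil (T m 1 * T (- m) 1)" "\<not> par m n"
  shows "nil (T m 1 * T n 1)"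
proof -
  define p where "p = n + m"
  have "\<not> par p m" using assms(2) by (simp add: p_def par_commute[of _ m] par_add_iff)
  then obtain u where u: "pairing u p = 0" "pairing u m = 1" using not_par_functional by blast
  let ?x = "D u p 1" and ?f = "T m 1 * T (- m) 1"
  have br: "br ?x ?f = T (p + m) 1 * T (- m) 1 - T m 1 * T n 1"
    unfolding br_simps D_T[OF u(1)] using u(2) by (simp add: p_def)
  have "nil (br ?x ?f)"
    using assms(1) by (intro nil_br_stable[OF stable_T_alg] T_alg_closed D_in_Gen u)
  then have "nil (br ?x ?f * T m 1)"
    by (rule nil_mult) (intro T_alg_commute T_alg_closed D_in_Gen u)
  moreover have "br ?x ?f * T m 1 = ?f * T (p + m) 1 - T m 1 * T m 1 * T n 1"
    unfolding br by (simp add: left_diff_distrib mult.assoc T_T T_left_commute)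
  ultimately have "nil (?f * T (p + m) 1 - T m 1 * T m 1 * T n 1)" by simp
  moreover have "nil (?f * T (p + m) 1)"
    using assms(1) by (rule nil_mult) (intro T_alg_commute T_alg_closed)
  ultimately have "nil (T m 1 * T m 1 * T n 1)"
    by (rule nil_diff) (intro T_alg_commute T_alg_closed)
  then have "nil (T m 1 * T m 1 * T n 1 * T n 1)"
    by (rule nil_mult) (intro T_alg_commute T_alg_closed)
  moreover have "T m 1 * T m 1 * T n 1 * T n 1 = (T m 1 * T n 1) ^ 2"
    by (simp add: power2_eq_square mult.assoc T_T T_left_commute)
  ultimately show ?thesis using nil_power by metis
qed

text \<open>Differentiating \<open>T m 1 * T n 1\<close> in direction \<open>n - m\<close> produces \<open>(T n 1)\<^sup>2\<close>.\<close>

lemma nil_T_of_not_par: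
  assumes nil: "nil (T m 1 * T (- m) 1)" and mn: "\<not> par m n"
  shows "nil (T n 1)"
proof -
  define q where "q = n - m"
  have "\<not> par q m" using mn by (simp add: q_def par_commute[of _ m] par_diff_iff)
  then obtain u where u: "pairing u q = 0" "pairing u m = 1" using not_par_functional by blast
  have un: "pairing u n = 1" using u by (simp add: q_def pairing_diff)
  let ?x = "D u q 1" and ?f = "T m 1 * T n 1"
  have br: "br ?x ?f = T m 1 * T (q + n) 1 + T n 1 * T n 1"
    unfolding br_simps D_T[OF u(1)] using u(2) un by (simp add: q_def)
  have "nil (br ?x ?f)"
    using nil_T_T_of_not_par[OF nil mn] by (intro nil_br_stable[OF stable_T_alg] T_alg_closed D_in_Gen u)
  then have "nil (T m 1 * T (q + n) 1 - (-1) *\<^sub>C (T n 1 * T n 1))" by (simp add: br)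
  moreover have "\<not> par m (q + n)"
    using mn by (auto simp: q_def par_def algebra_simps)
  then have "nil (T m 1 * T (q + n) 1)" by (rule nil_T_T_of_not_par[OF nil])
  ultimately have "nil ((-1) *\<^sub>C (T n 1 * T n 1))"
    by (rule nil_diff) (intro T_alg_commute T_alg_closed)
  then have "nil (T n 1 * T n 1)" 
    by (rule nil_scale_iff[THEN iffD1, of "-1", rotated]) simp
  then show ?thesis using nil_power[of "T n 1" 2] by (simp add: power2_eq_square)
qed

lemma nil_T_all:
  assumes nil: "nil (T m 1 * T (- m) 1)" and "m \<noteq> 0" "a \<noteq> 0"
  shows "nil (T a 1)"
proof (cases "par m a")
  case True
  obtain n where n: "\<not> par a n" using ex_not_par[OF assms(3) card] by blast
  then have "\<not> par m n" using True par_trans[of a m n] assms(2) par_commute by blast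
  then have "nil (T n 1)" by (rule nil_T_of_not_par[OF nil])
  then have "nil (T n 1 * T (- n) 1)" by (rule nil_mult) (rule T_T)
  moreover have "\<not> par n a" using n par_commute by blast
  ultimately show ?thesis by (rule nil_T_of_not_par)
qed (rule nil_T_of_not_par[OF nil])

text \<open>The product of the operators \<open>T m b\<close> over a list of pairs \<open>(m, b)\<close>.\<close>

definition T_prod :: "((int ^ 'n) \<times> 'b) list \<Rightarrow> 'v endo" where
  "T_prod ms = prod_list (map (\<lambda>(m, b). T m b) ms)"

lemma T_prod_simps [simp]:
  "T_prod [] = 1" "T_prod ((m, b) # ms) = T m b * T_prod ms" "T_prod (ms @ ns) = T_prod ms * T_prod ns"
  by (simp_all add: T_prod_def)

text \<open>All exponents in the list have an \<open>i\<close>-th coordinate whose sign is that of \<open>e\<close>.\<close>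

definition in_half_space :: "'n \<Rightarrow> int \<Rightarrow> ((int ^ 'n) \<times> 'b) list \<Rightarrow> bool" where
  "in_half_space i e ms \<longleftrightarrow> (\<forall>(m, b)\<in>set ms. e * m $ i > 0)"

lemma in_half_space_simps [simp]:
  "in_half_space i e []" "in_half_space i e ((m, b) # ms) \<longleftrightarrow> e * m $ i > 0 \<and> in_half_space i e ms"
  "in_half_space i e (ms @ ns) \<longleftrightarrow> in_half_space i e ms \<and> in_half_space i e ns"
  by (auto simp: in_half_space_def)

text \<open>If \<open>F\<close> kills all products of a given length over a half space, it kills their derivatives in
  directions from that half space. The prefix \<open>ps\<close> makes the induction on \<open>ms\<close> work.\<close>

lemma mult_br_T_prod_eq_0:
  assumes "\<And>ns. length ns = length ps + length ms \<Longrightarrow> in_half_space i e ns \<Longrightarrow> F * T_prod ns = 0"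
    and "in_half_space i e ps" "in_half_space i e ms" "pairing u q = 0" "e * q $ i > 0"
  shows "F * T_prod ps * br (D u q b) (T_prod ms) = 0"
  using assms(1-3)
proof (induction ms arbitrary: ps)
  case (Cons mc ms)
  obtain m c where mc: "mc = (m, c)" by fastforce
  have m: "e * m $ i > 0" using Cons.prems(3) by (simp add: mc)
  have "F * T_prod (ps @ (q + m, b * c) # ms) = 0"
    using Cons.prems m assms(5) by (intro Cons.prems(1)) (simp_all add: mc distrib_left)
  moreover have "F * T_prod (ps @ [(m, c)]) * br (D u q b) (T_prod ms) = 0"
    using Cons.prems m by (intro Cons.IH) (simp_all add: mc)
  ultimately show ?case
    by (simp add: mc br_simps D_T[OF assms(4)] distrib_left mult.assoc)
qed (simp add: br_simps)

text \<open>Polarisation: starting from \<open>T s 1 ^ k = 0\<close>, the derivation \<open>D u (m - s) b\<close> replaces one factor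
  \<open>T s 1\<close> by \<open>T m b\<close>. As \<open>s\<close> lies on the boundary of the half space, \<open>m - s\<close> is again in it, and
  the terms in which the other factors are differentiated vanish by induction.\<close>

lemma power_T_mult_T_prod_eq_0:
  assumes s: "s \<noteq> 0" "s $ i = 0" and k: "T s 1 ^ k = 0"
  shows "j \<le> k \<Longrightarrow> length ms = j \<Longrightarrow> in_half_space i e ms \<Longrightarrow> T s 1 ^ (k - j) * T_prod ms = 0"
proof (induction j arbitrary: ms)
  case 0
  then show ?case by (simp add: k)
next
  case (Suc j)
  then obtain m b ns where ms: "ms = (m, b) # ns" and len: "length ns = j"
    by (metis length_Suc_conv surj_pair)
  define a where "a = k - Suc j"
  have a: "k - j = Suc a" using Suc.prems(1) by (simp add: a_def)
  have m: "e * m $ i > 0" and ns: "in_half_space i e ns" using Suc.prems(3) by (simp_all add: ms)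
  define q where "q = m - s"
  have qi: "e * q $ i > 0" using m s(2) by (simp add: q_def)
  obtain l where "s $ l \<noteq> 0" using s(1) by (auto simp: vec_eq_iff)
  then have "q $ i * s $ l \<noteq> q $ l * s $ i" using qi s(2) by auto
  then have "\<not> par q s" unfolding par_def by blast
  then obtain u where u: "pairing u q = 0" "pairing u s = 1" using not_par_functional by blast
  let ?x = "D u q b" and ?t = "T s 1"
  have brt: "br ?x ?t = T m b" using u by (simp add: D_T q_def)
  have IH: "?t ^ Suc a * T_prod ns' = 0" if "length ns' = j" "in_half_space i e ns'" for ns'
    using Suc.IH[OF _ that] Suc.prems(1) unfolding a by simp
  have "0 = br ?x (?t ^ Suc a * T_prod ns)" unfolding IH[OF len ns] by (simp add: br_simps)
  also have "\<dots> = br ?x (?t ^ Suc a) * T_prod ns + ?t ^ Suc a * T_prod [] * br ?x (T_prod ns)"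
    by (simp add: br_simps(3) del: power_Suc)
  also have "?t ^ Suc a * T_prod [] * br ?x (T_prod ns) = 0"
    by (rule mult_br_T_prod_eq_0[OF _ _ ns u(1) qi]) (simp_all add: len IH del: power_Suc)
  also have "br ?x (?t ^ Suc a) = of_nat (Suc a) *\<^sub>C (?t ^ a * T m b)"
    using br_power[of ?t ?x a] by (simp only: brt T_T)
  finally have "of_nat (Suc a) *\<^sub>C (?t ^ a * T_prod ms) = 0" by (simp add: ms mult.assoc)
  then show ?case unfolding a_def[symmetric] by (simp del: of_nat_Suc)
qed

text \<open>Finitely many half spaces are treated one after the other; each time an \<open>s \<noteq> 0\<close> on the
  boundary is available because there are at least two coordinates.\<close>

lemma common_kernel_half_spaces:
  assumes nil: "\<And>a. a \<noteq> 0 \<Longrightarrow> nil (T a 1)" and "finite A"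
  shows "\<exists>v. v \<noteq> 0 \<and> (\<forall>(i, e)\<in>A. \<forall>m b. e * m $ i > 0 \<longrightarrow> app (T m b) v = 0)"
  using assms(2)
proof (induction A)
  case empty
  then show ?case using nontrivial by simp
next
  case (insert ie A)
  obtain i e where ie: "ie = (i, e)" by fastforce
  obtain v where v: "v \<noteq> 0" "\<And>i e m b. (i, e) \<in> A \<Longrightarrow> e * m $ i > 0 \<Longrightarrow> app (T m b) v = 0"
    using insert.IH by (auto simp: split_beta)
  obtain j where "j \<noteq> i" using ex_other_index[OF card] by blast
  then obtain s :: "int ^ 'n" where s: "s \<noteq> 0" "s $ i = 0"
    using that[of "axis j 1"] by (auto simp: axis_def vec_eq_iff)
  obtain k where k: "T s 1 ^ k = 0" using nil[OF s(1)] by (auto simp: nil_def)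
  let ?S = "{T m b | m b. e * m $ i > 0}"
  have as_T_prod: "\<exists>ms. xs = map (\<lambda>(m, b). T m b) ms \<and> in_half_space i e ms"
    if "set xs \<subseteq> ?S" for xs
    using that
  proof (induction xs)
    case (Cons x xs)
    then obtain m b ms where "x = T m b" "e * m $ i > 0"
      "xs = map (\<lambda>(m, b). T m b) ms" "in_half_space i e ms" by auto
    then show ?case by (intro exI[of _ "(m, b) # ms"]) simp
  qed simp
  have prod_0: "app (prod_list xs) v = 0" if xs: "set xs \<subseteq> ?S" "length xs = k" for xs
  proof -
    obtain ms where ms: "xs = map (\<lambda>(m, b). T m b) ms" "in_half_space i e ms"
      using as_T_prod[OF xs(1)] by blast
    then have "T_prod ms = 0" using power_T_mult_T_prod_eq_0[OF s k, of k ms e] xs(2) by simp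
    then show ?thesis by (simp add: ms(1) T_prod_def)
  qed
  have "\<exists>xs. set xs \<subseteq> ?S \<and> app (prod_list xs) v \<noteq> 0
      \<and> (\<forall>f\<in>?S. app f (app (prod_list xs) v) = 0)"
    by (rule common_kernel_of_products[OF v(1) prod_0])
  then obtain xs where "set xs \<subseteq> ?S \<and> app (prod_list xs) v \<noteq> 0
      \<and> (\<forall>f\<in>?S. app f (app (prod_list xs) v) = 0)" by (elim exE)
  then have xs: "set xs \<subseteq> ?S" "app (prod_list xs) v \<noteq> 0"
    "\<forall>f\<in>?S. app f (app (prod_list xs) v) = 0" by simp_all
  have "app (T m b) (app (prod_list xs) v) = 0" if "(i', e') \<in> A" "e' * m $ i' > 0" for i' e' m b
  proof -
    have "T m b * prod_list xs = prod_list xs * T m b"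
      using xs(1)
    proof (induction xs)
      case (Cons x xs)
      then have "x * T m b = T m b * x" by (auto simp: T_T)
      with Cons show ?case by (simp add: mult.assoc) (metis mult.assoc)
    qed simp
    then have "app (T m b * prod_list xs) v = app (prod_list xs * T m b) v" by simp
    then show ?thesis using v(2)[OF that] by simp
  qed
  moreover have "app (T m b) (app (prod_list xs) v) = 0" if "e * m $ i > 0" for m b
  proof -
    have "T m b \<in> ?S" using that by blast
    then show ?thesis by (rule xs(3)[rule_format])
  qed
  ultimately show ?case
    using xs(2) unfolding ie by (intro exI[of _ "app (prod_list xs) v"]) (auto simp del: mult_pos_pos)
qed

lemma not_nil_T_T:
  assumes "m \<noteq> 0"
  shows "\<not> nil (T m 1 * T (- m) 1)"
proof
  assume "nil (T m 1 * T (- m) 1)"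
  then have nil: "nil (T a 1)" if "a \<noteq> 0" for a using nil_T_all[OF _ assms that] by blast
  \<comment> \<open>The coordinate half spaces cover all nonzero vectors.\<close>
  have "finite (UNIV \<times> {1, -1} :: ('n \<times> int) set)" by simp
  from common_kernel_half_spaces[OF nil this] obtain w where w: "w \<noteq> 0"
    "\<forall>(i, e)\<in>UNIV \<times> {1, -1}. \<forall>m b. e * m $ i > 0 \<longrightarrow> app (T m b) w = 0" by blast
  have w0: "app (T a b) w = 0" if a: "a \<noteq> 0" for a b
  proof -
    obtain i where "a $ i \<noteq> 0" using a by (auto simp: vec_eq_iff)
    then have "1 * a $ i > 0 \<or> -1 * a $ i > 0" by linarith
    then obtain e where "e \<in> {1, -1}" "e * a $ i > 0" by blast
    then show ?thesis using w(2)[rule_format, of "(i, e)"] by auto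
  qed
  have "{v. \<forall>a b. a \<noteq> 0 \<longrightarrow> app (T a b) v = 0} = UNIV"
  proof (rule stable_subspace_UNIV)
    show "complex_vector.subspace {v. \<forall>a b. a \<noteq> 0 \<longrightarrow> app (T a b) v = 0}"
      by (rule complex_vector.subspaceI) auto
    show "w \<in> {v. \<forall>a b. a \<noteq> 0 \<longrightarrow> app (T a b) v = 0}" "w \<noteq> 0" using w0 w(1) by auto
    fix x v assume x: "x \<in> Gen" and v: "v \<in> {v. \<forall>a b. a \<noteq> 0 \<longrightarrow> app (T a b) v = 0}"
    have "app (T a b) (app x v) = 0" if a: "a \<noteq> 0" for a b
    proof -
      have "app (T a b * x) v = app (x * T a b - br x (T a b)) v"
        by (simp only: mult_eq_br[of "T a b" x])
      then have "app (T a b) (app x v) = - app (br x (T a b)) v" using v a by simp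
      also from x have "app (br x (T a b)) v = 0"
      proof (cases rule: GenE)
        case (D u r c)
        have "pairing u a = 0" if "r + a = 0" using pairing_add[of u r a] D(2) that by simp
        then show ?thesis unfolding D D_T[OF D(2)] using v by (cases "r + a = 0") auto
      next
        case (T r c)
        then show ?thesis using T_T by (simp add: br_def)
      qed
      finally show ?thesis by simp
    qed
    then show "app x v \<in> {v. \<forall>a b. a \<noteq> 0 \<longrightarrow> app (T a b) v = 0}" by simp
  qed
  moreover obtain s b where "s \<noteq> 0" "T s b \<noteq> 0" using T_nonzero by blast
  ultimately have "T s b = 0" by (intro endo_eqI) auto
  with \<open>T s b \<noteq> 0\<close> show False by contradiction
qed

lemma inj_T: "m \<noteq> 0 \<Longrightarrow> inj (app (T m 1))"
proof -
  assume "m \<noteq> 0"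
  then have "\<not> nil (T (- m) 1 * T m 1)" using not_nil_T_T[of "- m"] by simp
  moreover have "hom 0 (T (- m) 1 * T m 1)" using hom_mult[OF hom_T[of "- m" 1] hom_T[of m 1]] by simp
  moreover have "T (- m) 1 * T m 1 \<in> T_alg" by (intro T_alg_closed)
  ultimately have "inj (app (T (- m) 1 * T m 1))" using nil_of_not_inj[OF stable_T_alg] by blast
  then show ?thesis by (auto simp: inj_app_iff)
qed

end


context SA_operators
begin

section \<open>Operators of degree zero are scalars\<close>

lemma hom_0_scalar:
  assumes P: "stable_algebra P" and T_in_P: "\<And>m. T m 1 \<in> P" and f: "f \<in> P" "hom 0 f"
  shows "\<exists>c. f = c *\<^sub>C 1"
proof -
  note closed = stable_algebra_closed[OF P] and commute = stable_algebra_commute[OF P]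
  obtain \<mu> v where v: "\<mu> \<in> Lam" "v \<in> wt \<mu>" "v \<noteq> 0" using ex_weight by blast
  obtain c w where w: "w \<noteq> 0" "app f w = c *\<^sub>C w"
    using eigenvector_exists[OF subspace_wt hom_0_wt[OF f(2)] dim_bound_wt[OF v(1)] v(2,3)] by blast
  define g where "g = f - c *\<^sub>C 1"
  have g: "g \<in> P" "hom 0 g"
    unfolding g_def using f by (auto intro!: stable_algebra_diff[OF P] closed hom_diff hom_scale hom_1)
  have "\<not> inj (app g)" using w by (auto simp: inj_app_iff g_def)
  then have nil_g: "nil g" by (rule nil_of_not_inj[OF P g])
  let ?S = "{h \<in> P. hom 0 h \<and> nil h}"
  have prod_0: "app (prod_list xs) v = 0" if "set xs \<subseteq> ?S" "length xs = M" for xs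
  proof (rule prod_list_nilpotent_eq_0[OF subspace_wt _ that(1) _ _ _ v(2)])
    show "dim_bound (wt \<mu>) (length xs)" using dim_bound_wt[OF v(1)] that(2) by simp
    show "f * g = g * f" if "f \<in> ?S" "g \<in> ?S" for f g using that by (auto intro: commute)
    show "app f x \<in> wt \<mu>" if "f \<in> ?S" "x \<in> wt \<mu>" for f x using that by (auto intro: hom_0_wt)
    show "\<exists>n. app (f ^ n) x = 0" if f: "f \<in> ?S" for f x
    proof -
      obtain n where "f ^ n = 0" using f by (auto simp: nil_def)
      then show ?thesis by (intro exI[of _ n]) simp
    qed
  qed
  have "\<exists>xs. set xs \<subseteq> ?S \<and> app (prod_list xs) v \<noteq> 0
      \<and> (\<forall>h\<in>?S. app h (app (prod_list xs) v) = 0)"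
    by (rule common_kernel_of_products[OF v(3) prod_0])
  then obtain xs where xs: "app (prod_list xs) v \<noteq> 0" "\<forall>h\<in>?S. app h (app (prod_list xs) v) = 0"
    by (elim exE conjE)
  define x where "x = app (prod_list xs) v"
  have x: "x \<noteq> 0" "\<And>h. h \<in> P \<Longrightarrow> hom 0 h \<Longrightarrow> nil h \<Longrightarrow> app h x = 0"
    using xs by (simp_all add: x_def)
  \<comment> \<open>The common kernel of all homogeneous nilpotent elements is a submodule. Multiplication by the
    injective \<open>T (- m) 1\<close> moves degree \<open>m\<close> to degree 0, so a common kernel vector in degree 0 suffices.\<close>
  let ?K = "{v. \<forall>h m. h \<in> P \<longrightarrow> hom m h \<longrightarrow> nil h \<longrightarrow> app h v = 0}"
  have "?K = UNIV"
  proof (rule stable_subspace_UNIV)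
    show "complex_vector.subspace ?K" by (rule complex_vector.subspaceI) auto
    show "x \<noteq> 0" by (rule x(1))
    have "app h x = 0" if h: "h \<in> P" "hom m h" "nil h" for h m
    proof (cases "m = 0")
      case False
      have "hom (- m + m) (T (- m) 1 * h)" by (intro hom_mult hom_T h)
      moreover have "nil (T (- m) 1 * h)" using h(3) by (rule nil_mult) (intro commute T_in_P h)
      ultimately have "app (T (- m) 1 * h) x = 0" using closed T_in_P h(1) by (intro x(2)) auto
      then show ?thesis using inj_T[of "- m"] False by (simp add: inj_app_iff)
    qed (use h x(2) in auto)
    then show "x \<in> ?K" by blast
    fix y v assume y: "y \<in> Gen" and v: "v \<in> ?K"
    obtain r where r: "hom r y" using Gen_hom[OF y] by blast
    have "app h (app y v) = 0" if h: "h \<in> P" "hom m h" "nil h" for h m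
    proof -
      have "app (br y h) v = 0"
        using v closed(5)[OF y h(1)] hom_br[OF r h(2)] nil_br_stable[OF P h(1) y h(3)] by blast
      moreover have "app (h * y) v = app (y * h - br y h) v" by (simp only: mult_eq_br[of h y])
      moreover have "app h v = 0" using v h by blast
      ultimately show ?thesis by simp
    qed
    then show "app y v \<in> ?K" by blast
  qed
  then have "app g v = 0" for v using g nil_g by blast
  then have "g = 0" by (intro endo_eqI) simp
  then show ?thesis unfolding g_def by auto
qed

lemma T_neq_0: "m \<noteq> 0 \<Longrightarrow> T m 1 \<noteq> 0"
  using inj_T[of m] nontrivial by (auto simp: inj_app_iff)

lemma T_T_hom_0_scalar: "\<exists>c. T m b * T (- m) b' = c *\<^sub>C 1"
proof (rule hom_0_scalar[OF stable_T_alg T_in_T_alg])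
  show "T m b * T (- m) b' \<in> T_alg" by (intro T_alg_closed)
  show "hom 0 (T m b * T (- m) b')" using hom_mult[OF hom_T[of m b] hom_T[of "- m" b']] by simp
qed

lemma T_T_scalar:
  assumes "m \<noteq> 0"
  obtains \<alpha> where "\<alpha> \<noteq> 0" "T m 1 * T (- m) 1 = \<alpha> *\<^sub>C 1"
proof -
  obtain \<alpha> where \<alpha>: "T m 1 * T (- m) 1 = \<alpha> *\<^sub>C 1" using T_T_hom_0_scalar by blast
  have "\<alpha> \<noteq> 0"
  proof
    assume "\<alpha> = 0"
    then have "nil (T m 1 * T (- m) 1)" unfolding \<alpha> nil_def by (intro exI[of _ 1]) simp
    then show False using not_nil_T_T[OF assms] by blast
  qed
  then show ?thesis using \<alpha> that by blast
qed

lemma T_eq_scale: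
  assumes "m \<noteq> 0"
  shows "\<exists>c. T m b = c *\<^sub>C T m 1"
proof -
  obtain c where c: "T (- m) 1 * T m b = c *\<^sub>C 1" using T_T_hom_0_scalar T_T by metis
  obtain \<alpha> where \<alpha>: "\<alpha> \<noteq> 0" "T m 1 * T (- m) 1 = \<alpha> *\<^sub>C 1" using T_T_scalar[OF assms] .
  have "T (- m) 1 * (T m b - (c / \<alpha>) *\<^sub>C T m 1) = 0"
    using \<alpha> c T_T[of "- m" 1 m 1] by (simp add: right_diff_distrib)
  then have "app (T (- m) 1) (app (T m b - (c / \<alpha>) *\<^sub>C T m 1) v) = 0" for v
    by (metis app_simps(1,7))
  then have "app (T m b - (c / \<alpha>) *\<^sub>C T m 1) v = 0" for v
    using inj_T[of "- m"] assms unfolding inj_app_iff by (metis neg_equal_0_iff_equal)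
  then have "T m b - (c / \<alpha>) *\<^sub>C T m 1 = 0" by (intro endo_eqI) simp
  then show ?thesis by (intro exI[of _ "c / \<alpha>"]) simp
qed

text \<open>Commuting the relation \<open>T m b = k *\<^sub>C T m 1\<close> with \<open>D u (n - m) c\<close>.\<close>

lemma T_mult_of_not_par:
  assumes "T m b = k *\<^sub>C T m 1" "\<not> par m n"
  shows "T n (c * b) = k *\<^sub>C T n c"
proof -
  define r where "r = n - m"
  have "\<not> par r m" using assms(2) by (simp add: r_def par_commute[of _ m] par_diff_iff)
  then obtain u where u: "pairing u r = 0" "pairing u m = 1" using not_par_functional by blast
  have "br (D u r c) (T m b) = k *\<^sub>C br (D u r c) (T m 1)" unfolding assms(1) by (simp add: br_simps)
  then show ?thesis using u by (simp add: D_T r_def)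
qed

lemma ex_character: "\<exists>\<psi>. \<forall>m b. m \<noteq> 0 \<longrightarrow> T m b = \<psi> b *\<^sub>C T m 1"
proof -
  obtain e :: "int ^ 'n" where e: "e \<noteq> 0" using T_nonzero by blast
  then obtain \<psi> where \<psi>: "\<And>b. T e b = \<psi> b *\<^sub>C T e 1" using T_eq_scale by metis
  have "T m b = \<psi> b *\<^sub>C T m 1" if m: "m \<noteq> 0" for m b
  proof (cases "par e m")
    case True
    obtain a where a: "\<not> par m a" using ex_not_par[OF m card] by blast
    then have "\<not> par e a" using True par_trans[of m e a] e par_commute by blast
    then have "T a b = \<psi> b *\<^sub>C T a 1" using T_mult_of_not_par[OF \<psi>[of b], of a 1] by simp
    then show ?thesis using T_mult_of_not_par[of a b "\<psi> b" m 1] a par_commute[of a m] by simp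
  next
    case False
    then show ?thesis using T_mult_of_not_par[OF \<psi>[of b], of m 1] by simp
  qed
  then show ?thesis by blast
qed

text \<open>The character of \<open>B\<close> through which it acts on all \<open>T m 1\<close> with \<open>m \<noteq> 0\<close>. It need not describe
  the central operators \<open>T 0 b\<close>.\<close>

definition chi :: "'b \<Rightarrow> complex" where
  "chi = (SOME \<psi>. \<forall>m b. m \<noteq> 0 \<longrightarrow> T m b = \<psi> b *\<^sub>C T m 1)"

lemma T_chi: "m \<noteq> 0 \<Longrightarrow> T m b = chi b *\<^sub>C T m 1"
  using someI_ex[OF ex_character] unfolding chi_def by blast

lemma chi_unique:
  assumes "m \<noteq> 0" "T m b = k *\<^sub>C T m 1"
  shows "chi b = k"
  using T_chi[OF assms(1), of b] assms(2) T_neq_0[OF assms(1)] by simp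

lemma chi_simps:
  "chi 1 = 1" "chi (b + c) = chi b + chi c" "chi (k *\<^sub>C b) = k * chi b" "chi (b * c) = chi b * chi c"
proof -
  obtain m :: "int ^ 'n" where m: "m \<noteq> 0" using T_nonzero by blast
  show "chi 1 = 1" by (rule chi_unique[OF m]) simp
  show "chi (b + c) = chi b + chi c"
    by (rule chi_unique[OF m]) (simp add: T_add scaleC_add_left flip: T_chi[OF m])
  show "chi (k *\<^sub>C b) = k * chi b"
    by (rule chi_unique[OF m]) (simp add: T_scale T_chi[OF m, of b])
  obtain a where a: "\<not> par m a" using ex_not_par[OF m card] by blast
  then have a0: "a \<noteq> 0" by (auto simp: par_def)
  show "chi (b * c) = chi b * chi c"
    using T_mult_of_not_par[OF T_chi[OF m, of c] a, of b]
    by (intro chi_unique[OF a0]) (simp add: T_chi[OF a0, of b] mult.commute)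
qed

lemma D_commute_T:
  assumes "chi b = 0" "pairing u r = 0"
  shows "D u r b * T m c = T m c * D u r b"
proof -
  have "br (D u r b) (T m c) = 0"
  proof (cases "r + m = 0")
    case True
    then have "pairing u m = 0" using pairing_add[of u r m] assms(2) by simp
    then show ?thesis by (simp add: D_T[OF assms(2)])
  next
    case False
    have "T (r + m) (b * c) = 0" using T_chi[OF False, of "b * c"] assms(1) by (simp add: chi_simps)
    then show ?thesis by (simp add: D_T[OF assms(2)])
  qed
  then show ?thesis by (simp add: br_eq_0_iff)
qed

text \<open>An operator that commutes with the \<open>T m 1\<close> is determined by its values on one weight space,
  because \<open>T m 1\<close> maps that weight space onto its shift by \<open>m\<close>.\<close>

lemma eq_0_of_commute_T:
  assumes y: "\<And>m. y * T m 1 = T m 1 * y"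
    and \<mu>: "x \<in> wt \<mu>" "x \<noteq> 0" "\<And>v. v \<in> wt \<mu> \<Longrightarrow> app y v = 0"
  shows "y = 0"
proof (rule endo_eqI)
  fix z
  let ?W = "\<lambda>m. wt (\<lambda>u. \<mu> u + pairing u m)"
  let ?U = "complex_vector.span (\<Union>m. ?W m)"
  have "?U = UNIV"
  proof (rule stable_subspace_UNIV[OF complex_vector.subspace_span])
    have "x \<in> ?W 0" using \<mu>(1) by simp
    then have "x \<in> (\<Union>m. ?W m)" by blast
    then show "x \<in> ?U" by (rule complex_vector.span_base)
    show "x \<noteq> 0" by (rule \<mu>(2))
    fix f v assume f: "f \<in> Gen" and v: "v \<in> ?U"
    obtain r where r: "hom r f" using Gen_hom[OF f] by blast
    have "complex_vector.subspace {v. app f v \<in> ?U}"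
      by (rule complex_vector.subspaceI)
        (simp_all add: complex_vector.span_zero complex_vector.span_add complex_vector.span_scale)
    moreover have "(\<Union>m. ?W m) \<subseteq> {v. app f v \<in> ?U}"
    proof clarify
      fix m v assume "v \<in> ?W m"
      from hom_wt[OF r this] have "app f v \<in> ?W (m + r)" by (simp add: pairing_add add.assoc)
      then have "app f v \<in> (\<Union>m. ?W m)" by blast
      then show "app f v \<in> ?U" by (rule complex_vector.span_base)
    qed
    ultimately have "?U \<subseteq> {v. app f v \<in> ?U}" by (rule complex_vector.span_minimal[rotated])
    then show "app f v \<in> ?U" using v by blast
  qed
  moreover have "complex_vector.subspace {v. app y v = 0}"
    by (rule complex_vector.subspaceI) simp_all
  moreover have "(\<Union>m. ?W m) \<subseteq> {v. app y v = 0}"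
  proof clarify
    fix m v assume v: "v \<in> ?W m"
    show "app y v = 0"
    proof (cases "m = 0")
      case True
      then show ?thesis using v \<mu>(3) by simp
    next
      case False
      obtain \<alpha> where \<alpha>: "\<alpha> \<noteq> 0" "T m 1 * T (- m) 1 = \<alpha> *\<^sub>C 1" using T_T_scalar[OF False] .
      have "app (T (- m) 1) v \<in> wt \<mu>" using hom_wt[OF hom_T v, of "- m" 1] by simp
      then have "app (T m 1) (app y (app (T (- m) 1) v)) = 0" using \<mu>(3) by simp
      then have "app (y * (T m 1 * T (- m) 1)) v = 0"
        by (simp add: y flip: mult.assoc)
      then show ?thesis unfolding \<alpha>(2) using \<alpha>(1) by simp
    qed
  qed
  ultimately have "UNIV \<subseteq> {v. app y v = 0}" by (metis complex_vector.span_minimal)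
  then show "app y z = app 0 z" by auto
qed

end


section \<open>Vanishing of the vector fields over the kernel of the character\<close>

text \<open>The value at \<open>b\<close> of the monic polynomial with the roots \<open>\<delta>s\<close>.\<close>

definition root_prod :: "complex list \<Rightarrow> 'b::complex_comm_algebra_1 \<Rightarrow> 'b" where
  "root_prod \<delta>s b = prod_list (map (\<lambda>\<delta>. b - \<delta> *\<^sub>C 1) \<delta>s)"

lemma root_prod_simps [simp]:
  "root_prod [] b = 1" "root_prod (\<delta> # \<delta>s) b = (b - \<delta> *\<^sub>C 1) * root_prod \<delta>s b"
  "root_prod (\<delta>s @ \<epsilon>s) b = root_prod \<delta>s b * root_prod \<epsilon>s b"
  by (simp_all add: root_prod_def)

lemma lin_prod_commute: "lin_prod s \<beta>s * s = s * lin_prod s \<beta>s"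
proof (induction \<beta>s)
  case (Cons \<beta> \<beta>s)
  have "(s - \<beta> *\<^sub>C 1) * lin_prod s \<beta>s * s = (s - \<beta> *\<^sub>C 1) * s * lin_prod s \<beta>s"
    by (simp add: mult.assoc Cons)
  also have "(s - \<beta> *\<^sub>C 1) * s = s * (s - \<beta> *\<^sub>C 1)" by (simp add: algebra_simps)
  finally show ?case by (simp add: mult.assoc)
qed simp

text \<open>If \<open>br H (E c) = E (b * c)\<close>, multiplication by \<open>b\<close> acts on the operators \<open>E c\<close> as \<open>ad H\<close>,
  whose eigenvalues are differences of eigenvalues of \<open>H\<close>.\<close>

lemma root_prod_differences_kills:
  fixes E :: "'b::complex_comm_algebra_1 \<Rightarrow> 'v::complex_vector endo"
  assumes E: "\<And>c d. E (c + d) = E c + E d" "\<And>k c. E (k *\<^sub>C c) = k *\<^sub>C E c"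
    and br: "\<And>c. br H (E c) = E (b * c)"
    and W: "complex_vector.subspace W" "\<And>x. x \<in> W \<Longrightarrow> app H x \<in> W" "\<And>c x. x \<in> W \<Longrightarrow> app (E c) x \<in> W"
    and \<beta>s: "\<And>x. x \<in> W \<Longrightarrow> app (lin_prod H \<beta>s) x = 0"
  shows "x \<in> W \<Longrightarrow> app (lin_prod H \<gamma>s) x = 0 \<Longrightarrow>
    app (E (c * root_prod [\<beta> - \<gamma>. \<gamma> \<leftarrow> \<gamma>s, \<beta> \<leftarrow> \<beta>s] b)) x = 0"
proof (induction \<gamma>s arbitrary: x c)
  case Nil
  then show ?case by simp
next
  case (Cons \<gamma> \<gamma>s)
  let ?Q = "root_prod [\<beta> - \<gamma>. \<gamma> \<leftarrow> \<gamma>s, \<beta> \<leftarrow> \<beta>s] b"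
  define x' where "x' = app (H - \<gamma> *\<^sub>C 1) x"
  have "x' \<in> W"
    unfolding x'_def using Cons.prems(1) W
    by (simp add: complex_vector.subspace_diff complex_vector.subspace_scale)
  moreover have "lin_prod H \<gamma>s * (H - \<gamma> *\<^sub>C 1) = lin_prod H (\<gamma> # \<gamma>s)"
    using lin_prod_commute[of H \<gamma>s] by (simp add: algebra_simps)
  then have "app (lin_prod H \<gamma>s) x' = 0"
    using Cons.prems(2) unfolding x'_def app_simps(7)[symmetric] by simp
  ultimately have IH: "app (E (c * ?Q)) x' = 0" for c by (rule Cons.IH)
  have step: "app (lin_prod H bs) (app (E (c * ?Q)) x)
      = app (E (c * ?Q * root_prod (map (\<lambda>\<beta>. \<beta> - \<gamma>) bs) b)) x" for bs
  proof (induction bs)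
    case (Cons \<beta> bs)
    let ?c = "c * ?Q * root_prod (map (\<lambda>\<beta>. \<beta> - \<gamma>) bs) b"
    have "app (E ?c) x' = 0" using IH[of "c * root_prod (map (\<lambda>\<beta>. \<beta> - \<gamma>) bs) b"] by (simp add: ac_simps)
    then have *: "app (E ?c) (app H x) = \<gamma> *\<^sub>C app (E ?c) x" by (simp add: x'_def)
    have "H * E ?c = E (b * ?c) + E ?c * H" using br[of ?c] by (simp add: br_def algebra_simps)
    then have "app (H * E ?c) x = app (E (b * ?c) + E ?c * H) x" by simp
    then have H: "app H (app (E ?c) x) = app (E (b * ?c)) x + \<gamma> *\<^sub>C app (E ?c) x" using * by simp
    have "app (lin_prod H (\<beta> # bs)) (app (E (c * ?Q)) x) = app H (app (E ?c) x) - \<beta> *\<^sub>C app (E ?c) x"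
      by (simp add: Cons)
    also have "\<dots> = app (E (b * ?c) + (\<gamma> - \<beta>) *\<^sub>C E ?c) x"
      unfolding H by (simp add: complex_vector.scale_left_diff_distrib)
    also have "E (b * ?c) + (\<gamma> - \<beta>) *\<^sub>C E ?c = E (b * ?c + (\<gamma> - \<beta>) *\<^sub>C ?c)" by (simp add: E)
    also have "b * ?c + (\<gamma> - \<beta>) *\<^sub>C ?c = ?c * (b - (\<beta> - \<gamma>) *\<^sub>C 1)"
      by (simp only: right_diff_distrib mult_scaleC_right complex_vector.scale_left_diff_distrib
          mult_1_right mult.commute[of b]) simp
    finally show ?case by (simp add: ac_simps)
  qed simp
  have "app (E (c * ?Q)) x \<in> W" by (rule W(3)[OF Cons.prems(1)])
  then have "app (E (c * ?Q * root_prod (map (\<lambda>\<beta>. \<beta> - \<gamma>) \<beta>s) b)) x = 0" using \<beta>s step by metis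
  then show ?case by (simp add: ac_simps)
qed

text \<open>Modulo the ideal \<open>K\<close>, the element \<open>b\<close> is a root of two polynomials whose only possible common
  root is 0.\<close>

lemma power_mem_of_root_prods:
  fixes K :: "'b::complex_comm_algebra_1 set"
  assumes K: "\<And>a a'. a \<in> K \<Longrightarrow> a' \<in> K \<Longrightarrow> a + a' \<in> K" "\<And>a c. a \<in> K \<Longrightarrow> c * a \<in> K"
    and mem: "root_prod \<delta>s b \<in> K" "root_prod \<epsilon>s (j *\<^sub>C b) \<in> K"
    and j: "\<And>\<delta>. \<delta> \<in> set \<delta>s \<Longrightarrow> \<delta> \<noteq> 0 \<Longrightarrow> j * \<delta> \<notin> set \<epsilon>s"
  shows "\<exists>n. b ^ n \<in> K"
proof -
  have K_scale: "k *\<^sub>C a \<in> K" if "a \<in> K" for k a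
    using K(2)[OF that, of "k *\<^sub>C 1"] by (simp add: mult_scaleC_left)
  have eval: "y * root_prod es (j *\<^sub>C b) - prod_list (map (\<lambda>\<epsilon>. j * \<delta> - \<epsilon>) es) *\<^sub>C y \<in> K"
    if y: "y * (b - \<delta> *\<^sub>C 1) \<in> K" for y \<delta> es
  proof (induction es)
    case Nil
    show ?case using K_scale[OF y, of 0] by simp
  next
    case (Cons \<epsilon> es)
    let ?q = "root_prod es (j *\<^sub>C b)" and ?p = "prod_list (map (\<lambda>\<epsilon>. j * \<delta> - \<epsilon>) es)"
    have "(j *\<^sub>C b - \<epsilon> *\<^sub>C 1) * (y * ?q - ?p *\<^sub>C y) + (?p * j) *\<^sub>C (y * (b - \<delta> *\<^sub>C 1)) \<in> K"
      by (intro K Cons.IH K_scale y)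
    also have "(j *\<^sub>C b - \<epsilon> *\<^sub>C 1) * (y * ?q - ?p *\<^sub>C y) + (?p * j) *\<^sub>C (y * (b - \<delta> *\<^sub>C 1))
        = y * root_prod (\<epsilon> # es) (j *\<^sub>C b) - prod_list (map (\<lambda>\<epsilon>. j * \<delta> - \<epsilon>) (\<epsilon> # es)) *\<^sub>C y"
      by (simp add: algebra_simps mult_scaleC_right mult_scaleC_left scaleC_scaleC
          complex_vector.scale_left_diff_distrib complex_vector.scale_right_diff_distrib)
    finally show ?case .
  qed
  have cancel: "y \<in> K" if y: "y * (b - \<delta> *\<^sub>C 1) \<in> K" and \<delta>: "\<delta> \<in> set \<delta>s" "\<delta> \<noteq> 0" for y \<delta>
  proof -
    let ?p = "prod_list (map (\<lambda>\<epsilon>. j * \<delta> - \<epsilon>) \<epsilon>s)"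
    have p: "?p \<noteq> 0" using j[OF \<delta>] by (auto simp: prod_list_zero_iff)
    have "y * root_prod \<epsilon>s (j *\<^sub>C b) + (-1) *\<^sub>C (y * root_prod \<epsilon>s (j *\<^sub>C b) - ?p *\<^sub>C y) \<in> K"
      by (intro K mem K_scale eval y)
    then have "?p *\<^sub>C y \<in> K" by simp
    from K_scale[OF this, of "inverse ?p"] p show ?thesis by simp
  qed
  have "y * b ^ length (filter (\<lambda>\<delta>. \<delta> = 0) ds) \<in> K"
    if "set ds \<subseteq> set \<delta>s" "y * root_prod ds b \<in> K" for y ds
    using that
  proof (induction ds arbitrary: y)
    case (Cons \<delta> ds)
    show ?case
    proof (cases "\<delta> = 0")
      case True
      then show ?thesis using Cons.IH[of "y * b"] Cons.prems by (simp add: mult.assoc)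
    next
      case False
      have "y * root_prod ds b * (b - \<delta> *\<^sub>C 1) \<in> K" using Cons.prems(2) by (simp add: ac_simps)
      then have "y * root_prod ds b \<in> K" using cancel False Cons.prems(1) by simp
      then show ?thesis using Cons.IH[of y] Cons.prems False by simp
    qed
  qed simp
  from this[of \<delta>s 1] mem(1) show ?thesis by auto
qed

context SA_operators
begin

text \<open>For \<open>s = e\<^sub>1 + j e\<^sub>2\<close> and \<open>E w c = T (- s) 1 * D w s c\<close>, the commutators with \<open>D e\<^sub>1 0 b\<close> and
  \<open>D e\<^sub>2 0 b\<close> are \<open>E w (b * c)\<close> and \<open>j\<close> times \<open>E w (b * c)\<close>. A nonzero eigenvalue \<open>\<delta>\<close> of
  multiplication by \<open>b\<close> on these operators would make \<open>\<delta>\<close> and \<open>j \<delta>\<close> differences of eigenvalues of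
  the two operators on a weight space, which only finitely many \<open>j\<close> permit.\<close>

lemma ex_power_vanishing_direction:
  assumes b: "chi b = 0"
  shows "\<exists>s n. s \<noteq> 0 \<and> (\<forall>w c. pairing w s = 0 \<longrightarrow> D w s (c * b ^ n) = 0)"
proof -
  obtain \<mu> x where \<mu>: "\<mu> \<in> Lam" "x \<in> wt \<mu>" "x \<noteq> 0" using ex_weight by blast
  obtain i1 i2 :: 'n where i: "i2 \<noteq> i1" using ex_other_index[OF card] by blast
  define H where "H i = D (axis i 1) 0 b" for i
  have H0: "hom 0 (H i)" for i unfolding H_def by (rule hom_D) simp
  have "\<exists>\<beta>s. \<forall>v\<in>wt \<mu>. app (lin_prod (H i) \<beta>s) v = 0" for i
    by (rule annihilating_lin_prod[OF subspace_wt hom_0_wt[OF H0] dim_bound_wt[OF \<mu>(1)]])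
  then obtain \<beta>s where \<beta>s: "\<And>i v. v \<in> wt \<mu> \<Longrightarrow> app (lin_prod (H i) (\<beta>s i)) v = 0" by metis
  define \<delta>s where "\<delta>s i = [\<beta> - \<gamma>. \<gamma> \<leftarrow> \<beta>s i, \<beta> \<leftarrow> \<beta>s i]" for i
  let ?bad = "(\<lambda>(\<delta>, \<epsilon>). \<epsilon> / \<delta>) ` (set (\<delta>s i1) \<times> set (\<delta>s i2))"
  have "finite {j :: int. of_int j \<in> ?bad}"
    by (rule finite_vimageI[of ?bad "of_int", unfolded vimage_def]) (auto simp: inj_def)
  then obtain j :: int where j: "of_int j \<notin> ?bad" using ex_new_if_finite infinite_UNIV_int by blast
  define s :: "int ^ 'n" where "s = (\<chi> k. if k = i1 then 1 else if k = i2 then j else 0)"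
  have s1: "s $ i1 = 1" "s $ i2 = j" using i by (simp_all add: s_def)
  have s0: "s \<noteq> 0" using s1(1) by auto
  define E where "E w c = T (- s) 1 * D w s c" for w c
  have E_lin: "E w (c + d) = E w c + E w d" "E w (k *\<^sub>C c) = k *\<^sub>C E w c" for w c d k
    by (simp_all add: E_def D_add D_scale distrib_left)
  have E_hom: "hom 0 (E w c)" if "pairing w s = 0" for w c
    using hom_mult[OF hom_T[of "- s" 1] hom_D[OF that, of c]] by (simp add: E_def)
  have H_E: "br (H i) (E w c) = E w ((of_int (s $ i) *\<^sub>C b) * c)" if w: "pairing w s = 0" for i w c
  proof -
    have "br (H i) (T (- s) 1) = 0" using D_commute_T[OF b] by (simp add: br_eq_0_iff H_def)
    moreover have "br (H i) (D w s c) = of_int (s $ i) *\<^sub>C D w s (b * c)"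
      unfolding H_def by (subst D_D) (simp_all add: w D_scale_left)
    ultimately show ?thesis by (simp add: E_def br_simps mult_scaleC_left D_scale)
  qed
  have kill: "app (E w (c * root_prod (\<delta>s i) (of_int (s $ i) *\<^sub>C b))) v = 0"
    if w: "pairing w s = 0" and v: "v \<in> wt \<mu>" for i w c v
    unfolding \<delta>s_def
    by (rule root_prod_differences_kills[OF E_lin H_E[OF w] subspace_wt hom_0_wt[OF H0]
          hom_0_wt[OF E_hom[OF w]] \<beta>s v \<beta>s[OF v]])
  let ?K = "{a. \<forall>w c. pairing w s = 0 \<longrightarrow> (\<forall>v\<in>wt \<mu>. app (E w (c * a)) v = 0)}"
  have "\<exists>n. b ^ n \<in> ?K"
  proof (rule power_mem_of_root_prods)
    show "a + a' \<in> ?K" if "a \<in> ?K" "a' \<in> ?K" for a a'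
      using that by (simp add: distrib_left E_lin)
    show "c * a \<in> ?K" if "a \<in> ?K" for a c
      using that by (simp flip: mult.assoc)
    show "root_prod (\<delta>s i1) b \<in> ?K" using kill[of _ _ _ i1] s1 by simp
    show "root_prod (\<delta>s i2) (of_int j *\<^sub>C b) \<in> ?K" using kill[of _ _ _ i2] s1 by simp
    fix \<delta> assume \<delta>: "\<delta> \<in> set (\<delta>s i1)" "\<delta> \<noteq> 0"
    show "of_int j * \<delta> \<notin> set (\<delta>s i2)"
    proof
      assume "of_int j * \<delta> \<in> set (\<delta>s i2)"
      then have "of_int j * \<delta> / \<delta> \<in> ?bad" using \<delta>(1) by (intro image_eqI[of _ _ "(\<delta>, of_int j * \<delta>)"]) auto
      then show False using j \<delta>(2) by simp
    qed
  qed
  then obtain n where n: "\<And>w c v. pairing w s = 0 \<Longrightarrow> v \<in> wt \<mu> \<Longrightarrow> app (E w (c * b ^ n)) v = 0"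
    by blast
  \<comment> \<open>The additional factor \<open>b\<close> ensures that the operator commutes with the \<open>T m 1\<close> even if \<open>n = 0\<close>.\<close>
  have "D w s (c * b ^ Suc n) = 0" if w: "pairing w s = 0" for w c
  proof (rule eq_0_of_commute_T[OF _ \<mu>(2,3)])
    have "chi (c * b ^ Suc n) = 0" using b by (simp add: chi_simps)
    then show "D w s (c * b ^ Suc n) * T m 1 = T m 1 * D w s (c * b ^ Suc n)" for m
      by (rule D_commute_T[OF _ w])
    fix v assume "v \<in> wt \<mu>"
    then have "app (T (- s) 1) (app (D w s (c * b ^ Suc n)) v) = 0"
      using n[OF w, of v "c * b"] by (simp add: E_def mult.assoc)
    then show "app (D w s (c * b ^ Suc n)) v = 0"
      using inj_T[of "- s"] s0 by (simp add: inj_app_iff)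
  qed
  then show ?thesis using s0 by blast
qed

text \<open>The ideal of those \<open>a\<close> whose multiples annihilate, as coefficients, all \<open>D w r\<close> with \<open>r \<noteq> 0\<close>.\<close>

definition D_vanishing :: "'b \<Rightarrow> bool" where
  "D_vanishing a \<longleftrightarrow> (\<forall>r w c. r \<noteq> 0 \<longrightarrow> pairing w r = 0 \<longrightarrow> D w r (c * a) = 0)"

lemma D_vanishing_mult: "D_vanishing a \<Longrightarrow> D_vanishing (c * a)"
  unfolding D_vanishing_def by (metis mult.assoc)

lemma D_zero_vector: "D 0 r b = 0"
  using D_scale_left[of 0 r 0 b] by (simp add: pairing_def)

text \<open>Here \<open>D w r\<close> is the bracket of \<open>D w' s\<close> and \<open>D w'' (r - s)\<close> for suitable \<open>w'\<close> and \<open>w''\<close>.\<close>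

lemma D_eq_0_of_not_par:
  assumes van: "\<And>w c. pairing w s = 0 \<Longrightarrow> D w s (c * a) = 0"
    and "\<not> par s r" "pairing w r = 0"
  shows "D w r (c * a) = 0"
proof -
  obtain w' where w': "pairing w' s = 0" "pairing w' r = 1"
    using not_par_functional[OF assms(2)] by blast
  define \<kappa> where "\<kappa> = pairing w s"
  define w'' where "w'' = w + \<kappa> *\<^sub>C w'"
  have p: "pairing w' (r - s) = 1" "pairing w'' (r - s) = 0" "pairing w'' s = \<kappa>"
    using w' assms(3) by (simp_all add: w''_def \<kappa>_def pairing_diff pairing_add_left)
  have "D w' s (1 * a) = 0" by (rule van[OF w'(1)])
  then have "br (D w' s a) (D w'' (r - s) c) = 0" by (simp add: br_def)
  then show ?thesis
    unfolding D_D[OF w'(1) p(2)] p by (simp add: w''_def mult.commute)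
qed

lemma ex_power_D_vanishing:
  assumes "chi b = 0"
  shows "\<exists>n. D_vanishing (b ^ n)"
proof -
  obtain s n where s: "s \<noteq> 0" and van: "\<And>w c. pairing w s = 0 \<Longrightarrow> D w s (c * b ^ n) = 0"
    using ex_power_vanishing_direction[OF assms] by blast
  have "D w r (c * b ^ n) = 0" if r: "r \<noteq> 0" "pairing w r = 0" for r w c
  proof (cases "par s r")
    case True
    obtain r' where r': "\<not> par s r'" using ex_not_par[OF s card] by blast
    then have "\<not> par r' r" using True par_trans[of r' r s] r(1) par_commute by blast
    then show ?thesis using D_eq_0_of_not_par[OF D_eq_0_of_not_par[OF van r']] r(2) by blast
  next
    case False
    from D_eq_0_of_not_par[OF van this r(2)] show ?thesis .
  qed
  then show ?thesis unfolding D_vanishing_def by blast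
qed

text \<open>The algebra generated by the \<open>T r c\<close> and the \<open>D w r (c * b)\<close>, with \<open>r = 0\<close> included, is
  commutative because the bracket of two operators \<open>D w r (c * b)\<close> carries the coefficient \<open>b\<^sup>2\<close>.\<close>

lemma D_vanishing_of_square:
  assumes b: "chi b = 0" and sq: "D_vanishing (b * b)"
  shows "D_vanishing b"
proof -
  define G where "G = {T r c | r c. True} \<union> {D w r (c * b) | w r c. pairing w r = 0}"
  have TG: "T r c \<in> G" for r c by (auto simp: G_def)
  have DG: "D w r (c * b) \<in> G" if "pairing w r = 0" for w r c
    unfolding G_def using that by blast
  have chi: "chi (c * b) = 0" for c using b by (simp add: chi_simps)
  have T_D: "D w r (c * b) * T s d = T s d * D w r (c * b)" if "pairing w r = 0" for w r c s d
    by (rule D_commute_T[OF chi that])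
  have D_D_G: "D w r (c * b) * D w' s (c' * b) = D w' s (c' * b) * D w r (c * b)"
    if w: "pairing w r = 0" "pairing w' s = 0" for w r c w' s c'
  proof -
    let ?v = "pairing w s *\<^sub>C w' - pairing w' r *\<^sub>C w"
    have "D ?v (r + s) ((c * c') * (b * b)) = 0"
    proof (cases "r + s = 0")
      case True
        \<comment> \<open>Opposite degrees: both coefficients vanish, and so does the bracket.\<close>
      then have "pairing w s = 0" "pairing w' r = 0"
        using pairing_add[of w r s] pairing_add[of w' r s] w by simp_all
      then show ?thesis by (simp add: D_zero_vector)
    next
      case False
      moreover have "pairing ?v (r + s) = 0" by (simp add: pairing_bracket pairing_add w)
      ultimately show ?thesis using sq unfolding D_vanishing_def by blast
    qed
    then have "br (D w r (c * b)) (D w' s (c' * b)) = 0" by (simp add: D_D w ac_simps)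
    then show ?thesis by (simp add: br_eq_0_iff)
  qed
  have stable: "stable_algebra (gen_alg G)"
  proof (rule stable_algebra_gen_alg)
    fix g h assume "g \<in> G" "h \<in> G"
    then show "g * h = h * g"
      unfolding G_def by (elim UnE; clarify) (simp_all add: T_T T_D D_D_G)
  next
    fix x g assume x: "x \<in> Gen" and g: "g \<in> G"
    have zero: "0 \<in> gen_alg G" using gen_alg_scale[OF gen_alg_one, of 0 G] by simp
    from g consider (T) s c where "g = T s c" | (D) w s c where "g = D w s (c * b)" "pairing w s = 0"
      unfolding G_def by blast
    then show "br x g \<in> gen_alg G"
    proof cases
      case g: (T s c)
      from x show ?thesis
      proof (cases rule: GenE)
        case (D u r d)
        then show ?thesis unfolding D g D_T[OF D(2)] by (intro gen_alg_scale gen_alg_base TG)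
      next
        case (T r d)
        then show ?thesis using zero T_T by (simp add: g br_def)
      qed
    next
      case g: (D w s c)
      from x show ?thesis
      proof (cases rule: GenE)
        case (D u r d)
        have "pairing (pairing u s *\<^sub>C w - pairing w r *\<^sub>C u) (r + s) = 0"
          by (simp add: pairing_bracket pairing_add g D)
        then show ?thesis
          unfolding D g(1) D_D[OF D(2) g(2)] mult.assoc[symmetric] by (intro gen_alg_base DG)
      next
        case (T r d)
        then show ?thesis using zero T_D[OF g(2)] by (simp add: g br_def)
      qed
    qed
  qed
  have "D w r (c * b) = 0" if r: "r \<noteq> 0" and w: "pairing w r = 0" for r w c
  proof -
    obtain i where i: "r $ i \<noteq> 0" using r by (auto simp: vec_eq_iff)
    define v :: "complex ^ 'n" where "v = inverse (of_int (r $ i)) *\<^sub>C axis i 1"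
    have v: "pairing v r = 1" using i by (simp add: v_def)
    have "D v 0 (c * b) \<in> gen_alg G" "hom 0 (D v 0 (c * b))"
      using gen_alg_base[OF DG] hom_D by simp_all
    then have "\<exists>k. D v 0 (c * b) = k *\<^sub>C 1" by (rule hom_0_scalar[OF stable gen_alg_base[OF TG]])
    then obtain k where "D v 0 (c * b) = k *\<^sub>C 1" by (elim exE)
    then have "br (D v 0 (c * b)) (D w r 1) = 0" by (simp add: br_def)
    then show ?thesis by (simp add: D_D w v)
  qed
  then show ?thesis unfolding D_vanishing_def by blast
qed

text \<open>If \<open>b ^ n\<close> is the least power of \<open>b\<close> in the ideal and \<open>n \<ge> 2\<close>, the square of \<open>b ^ (n - 1)\<close> is
  a multiple of \<open>b ^ n\<close>, contrary to the choice of \<open>n\<close>.\<close>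

lemma D_vanishing_of_chi:
  assumes "chi b = 0"
  shows "D_vanishing b"
proof -
  define n where "n = (LEAST n. D_vanishing (b ^ n))"
  have n: "D_vanishing (b ^ n)"
    unfolding n_def using ex_power_D_vanishing[OF assms] by (rule LeastI_ex)
  have "n \<le> 1"
  proof (rule ccontr)
    assume "\<not> n \<le> 1"
    then obtain k where k: "n = Suc (Suc k)" by (metis One_nat_def le_SucI not_less_eq_eq not0_implies_Suc le0)
    let ?a = "b ^ Suc k"
    have "?a * ?a = b ^ k * b ^ n" by (simp add: k ac_simps)
    then have "D_vanishing (?a * ?a)" using D_vanishing_mult[OF n] by simp
    moreover have "chi ?a = 0" using assms by (simp add: chi_simps)
    ultimately have "D_vanishing ?a" by (rule D_vanishing_of_square[rotated])
    then show False using not_less_Least[of "Suc k" "\<lambda>n. D_vanishing (b ^ n)"] k by (simp add: n_def)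
  qed
  then consider "n = 0" | "n = 1" by linarith
  then show ?thesis using n D_vanishing_mult[of 1 b] by cases simp_all
qed

lemma D_0_scalar_of_chi:
  assumes b: "chi b = 0"
  shows "\<exists>c. D u 0 b = c *\<^sub>C 1"
proof (rule central_scalar)
  fix x assume "x \<in> Gen"
  then show "x * D u 0 b = D u 0 b * x"
  proof (cases rule: GenE)
    case (D v s c)
    have "D (pairing u s *\<^sub>C v) s (c * b) = 0"
    proof (cases "s = 0")
      case False
      then show ?thesis using D_vanishing_of_chi[OF b] D(2) by (simp add: D_vanishing_def)
    qed (simp add: D_zero_vector)
    then have "br (D u 0 b) (D v s c) = 0" by (simp add: D_D D(2) mult.commute)
    then show ?thesis by (simp add: D br_eq_0_iff)
  next
    case (T s c)
    then show ?thesis using D_commute_T[OF b] by simp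
  qed
qed

lemma D_0_eq: "\<exists>c. D u 0 b = c *\<^sub>C 1 + chi b *\<^sub>C D u 0 1"
proof -
  have "chi (b + (- chi b) *\<^sub>C 1) = 0" by (simp only: chi_simps) simp
  from D_0_scalar_of_chi[OF this] obtain c where "D u 0 (b + (- chi b) *\<^sub>C 1) = c *\<^sub>C 1" by blast
  then have "D u 0 b + (- chi b) *\<^sub>C D u 0 1 = c *\<^sub>C 1" by (simp only: D_add D_scale)
  then show ?thesis by (intro exI[of _ c]) (simp add: algebra_simps)
qed

end


section \<open>Spanning sets of the Lie algebra\<close>

lemma tensor_of_0_left: "0 \<otimes>\<^sub>C b = 0"
  using tensor_of_scale_left[of 0 0 b] by simp

lemma vfield_add_left: "vfield (u + v) r = vfield u r + vfield v r"
  by (simp add: vfield_def fun_eq_iff scaleC_add_left sum.distrib)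

lemma vfield_scale_left: "vfield (k *\<^sub>C u) r = k *\<^sub>C vfield u r"
  by (simp add: vfield_def fun_eq_iff scaleC_vec_def complex_vector.scale_sum_right)

lemma zero_in_div_free: "0 \<in> div_free"
  by (rule complex_vector.subspace_0[OF subspace_div_free])

lemma SA_D_scale:
  assumes "pairing u r = 0"
  shows "SA_D (k *\<^sub>C u) r = k *\<^sub>C SA_D u r"
  by (simp add: SA_D_def scaleC_SA.abs_eq eq_onp_def vfield_in_div_free assms vfield_scale_left)

lemma SA_D_0_add: "SA_D (u + v) 0 = SA_D u 0 + SA_D v 0"
  by (simp add: SA_D_def plus_SA.abs_eq eq_onp_def vfield_in_div_free vfield_add_left)

lemma SA_D_0_eq_sum: "SA_D u 0 = (\<Sum>i\<in>UNIV. u $ i *\<^sub>C SA_d i)" for u :: "complex ^ 'n::finite"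
proof -
  have lin: "clinear (\<lambda>u :: complex ^ 'n. SA_D u 0)"
    by (rule clinearI) (simp_all add: SA_D_0_add SA_D_scale)
  have "u = (\<Sum>i\<in>UNIV. u $ i *\<^sub>C axis i 1)"
    by (simp add: vec_eq_iff scaleC_vec_def axis_def if_distrib[of "\<lambda>t. _ * t"] cong: if_cong)
  then have "SA_D u 0 = SA_D (\<Sum>i\<in>UNIV. u $ i *\<^sub>C axis i 1) 0" by simp
  also have "\<dots> = (\<Sum>i\<in>UNIV. u $ i *\<^sub>C SA_d i)"
    by (simp only: clinear_sum[OF lin] clinear_scale[OF lin] SA_d_eq)
  finally show ?thesis .
qed

lemma cartan_eq: "cartan = range (\<lambda>u. SA_D u 0)"
proof
  have "complex_vector.subspace (range (\<lambda>u. SA_D u 0) :: 'a SA set)"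
  proof (rule complex_vector.subspaceI)
    show "0 \<in> range (\<lambda>u. SA_D u 0 :: 'a SA)"
      by (rule range_eqI[of _ _ 0]) (simp add: SA_D_0_eq_sum)
    fix x y :: "'a SA" and c assume "x \<in> range (\<lambda>u. SA_D u 0)"
    then obtain u where u: "x = SA_D u 0" by blast
    show "c *\<^sub>C x \<in> range (\<lambda>u. SA_D u 0)"
      by (rule range_eqI[of _ _ "c *\<^sub>C u"]) (simp add: SA_D_scale u)
    assume "y \<in> range (\<lambda>u. SA_D u 0)"
    then obtain v where v: "y = SA_D v 0" by blast
    show "x + y \<in> range (\<lambda>u. SA_D u 0)"
      by (rule range_eqI[of _ _ "u + v"]) (simp add: SA_D_0_add u v)
  qed
  then show "cartan \<subseteq> range (\<lambda>u. SA_D u 0 :: 'a SA)"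
    unfolding cartan_def by (rule complex_vector.span_minimal[rotated]) (auto simp: SA_d_eq)
  show "range (\<lambda>u. SA_D u 0 :: 'a SA) \<subseteq> cartan"
    unfolding cartan_def SA_D_0_eq_sum
    by (clarify, intro complex_vector.span_sum complex_vector.span_scale complex_vector.span_base rangeI)
qed

lemma SA_mem_subspace:
  fixes X :: "'n::finite SA"
  assumes D: "\<And>u r. pairing u r = 0 \<Longrightarrow> SA_D u r \<in> S" and t: "\<And>s. SA_t s \<in> S"
    and S: "complex_vector.subspace S"
  shows "X \<in> S"
proof -
  have div: "Abs_SA (Y, 0) \<in> S" if "Y \<in> div_free" for Y :: "'n laurent \<Rightarrow> 'n laurent"
  proof -
    from that[unfolded div_free_def] have "Y \<in> div_free \<and> Abs_SA (Y, 0) \<in> S"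
    proof (induction rule: complex_vector.span_induct_alt)
      case base
      show ?case
        using complex_vector.subspace_0[OF S] zero_in_div_free unfolding zero_SA_def by blast
    next
      case (step c x y)
      then obtain u r where x: "x = vfield u r" "pairing u r = 0" by blast
      have xd: "x \<in> div_free" unfolding x(1) by (rule vfield_in_div_free[OF x(2)])
      then have cx: "c *\<^sub>C x \<in> div_free" by (rule complex_vector.subspace_scale[OF subspace_div_free])
      have "Abs_SA (c *\<^sub>C x + y, 0) = c *\<^sub>C SA_D u r + Abs_SA (y, 0)"
        using step xd cx by (simp add: SA_D_def plus_SA.abs_eq scaleC_SA.abs_eq eq_onp_def flip: x(1))
      moreover have "c *\<^sub>C SA_D u r + Abs_SA (y, 0) \<in> S"
        using step(2) by (intro complex_vector.subspace_add[OF S] complex_vector.subspace_scale[OF S] D x(2)) blast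
      moreover have "c *\<^sub>C x + y \<in> div_free"
        using step(2) by (intro complex_vector.subspace_add[OF subspace_div_free] cx) blast
      ultimately show ?case by metis
    qed
    then show ?thesis by blast
  qed
  have mult: "Abs_SA (0, f) \<in> S" for f :: "'n laurent"
  proof -
    have "Abs_SA (0, \<Sum>m\<in>K. c m *\<^sub>C tpow m) \<in> S" if "finite K" for K :: "(int ^ 'n) set" and c
      using that
    proof (induction K)
      case empty
      show ?case using complex_vector.subspace_0[OF S] unfolding zero_SA_def sum.empty .
    next
      case (insert m K)
      then have "Abs_SA (0, \<Sum>m\<in>insert m K. c m *\<^sub>C tpow m)
          = c m *\<^sub>C SA_t m + Abs_SA (0, \<Sum>m\<in>K. c m *\<^sub>C tpow m)"
        by (simp add: SA_t_def plus_SA.abs_eq scaleC_SA.abs_eq eq_onp_def zero_in_div_free)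
      moreover have "c m *\<^sub>C SA_t m + Abs_SA (0, \<Sum>m\<in>K. c m *\<^sub>C tpow m) \<in> S"
        by (intro complex_vector.subspace_add[OF S] complex_vector.subspace_scale[OF S] t insert.IH)
      ultimately show ?case by metis
    qed
    then have "Abs_SA (0, \<Sum>m\<in>Poly_Mapping.keys f. Poly_Mapping.lookup f m *\<^sub>C tpow m) \<in> S" by simp
    also have "(\<Sum>m\<in>Poly_Mapping.keys f. Poly_Mapping.lookup f m *\<^sub>C tpow m) = f"
      by (subst (3) poly_mapping_sum_single) (simp add: tpow_def scaleC_single)
    finally show ?thesis .
  qed
  obtain Y f where X: "X = Abs_SA (Y, f)" "Y \<in> div_free" by (cases X) auto
  have "X = Abs_SA (Y, 0) + Abs_SA (0, f)"
    using X by (simp add: plus_SA.abs_eq eq_onp_def zero_in_div_free)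
  then show ?thesis using div[OF X(2)] mult[of f] complex_vector.subspace_add[OF S] by simp
qed

lemma stable_of_generators:
  fixes \<rho> :: "('n::finite SA, 'b::complex_comm_algebra_1) tensor \<Rightarrow> 'v::complex_vector \<Rightarrow> 'v"
  assumes \<rho>: "cbilinear \<rho>" and U: "complex_vector.subspace U"
    and D: "\<And>u r b v. pairing u r = 0 \<Longrightarrow> v \<in> U \<Longrightarrow> \<rho> (SA_D u r \<otimes>\<^sub>C b) v \<in> U"
    and t: "\<And>s b v. v \<in> U \<Longrightarrow> \<rho> (SA_t s \<otimes>\<^sub>C b) v \<in> U"
  shows "lie_submodule \<rho> U"
proof -
  have lin: "\<rho> (x + y) v = \<rho> x v + \<rho> y v" "\<rho> (c *\<^sub>C x) v = c *\<^sub>C \<rho> x v" for x y c v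
    using \<rho> by (simp_all add: cbilinear_def Vector_Spaces.linear_iff)
  have "\<rho> x v \<in> U" if v: "v \<in> U" for x v
  proof (induction x rule: tensor_induct)
    case (pure X b)
    have "X \<in> {X. \<rho> (X \<otimes>\<^sub>C b) v \<in> U}"
    proof (rule SA_mem_subspace)
      show "complex_vector.subspace {X. \<rho> (X \<otimes>\<^sub>C b) v \<in> U}"
      proof (rule complex_vector.subspaceI)
        have "\<rho> (0 \<otimes>\<^sub>C b) v = 0"
          using lin(2)[of 0 0 v] by (simp add: tensor_of_0_left)
        then show "0 \<in> {X. \<rho> (X \<otimes>\<^sub>C b) v \<in> U}" using complex_vector.subspace_0[OF U] by simp
      qed (auto simp: tensor_of_add_left tensor_of_scale_left lin
          intro: complex_vector.subspace_add[OF U] complex_vector.subspace_scale[OF U])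
    qed (use D t v in auto)
    then show ?case by simp
  qed (auto simp: lin intro: complex_vector.subspace_add[OF U] complex_vector.subspace_scale[OF U])
  then show ?thesis using U by (simp add: lie_submodule_def)
qed


section \<open>The action on a weight space\<close>

theorem corollary3p13:
  fixes \<rho> :: "('n::finite SA, 'b::complex_comm_algebra_1) tensor \<Rightarrow> 'v::complex_vector \<Rightarrow> 'v"
    and \<mu> :: "'n SA \<Rightarrow> complex"
    and \<Lambda> :: "complex ^ 'n"
  assumes "CARD('n) \<ge> 2"
    and "\<exists>G :: 'b set. finite G \<and> subalgebra hull G = UNIV"
    and "uniformly_bounded_weight_module \<rho>"
    and "irreducible_module \<rho>"
    and "\<exists>v. \<rho> (SA_t 0 \<otimes>\<^sub>C 1) v \<noteq> 0"
    and "\<exists>s. s \<noteq> 0 \<and> (\<exists>v. \<rho> (SA_t s \<otimes>\<^sub>C 1) v \<noteq> 0)"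
    and "is_weight \<rho> \<mu>"
    and "\<Lambda> = (\<chi> i. \<mu> (SA_d i))"
  shows "\<forall>u b. \<exists>c. \<forall>v\<in>weight_space_coord \<rho> \<Lambda>. \<rho> (SA_D u 0 \<otimes>\<^sub>C b) v = c *\<^sub>C v"
proof -
  have mod: "lie_module \<rho>" and dec: "direct_sum_decomp (dual_space cartan) (weight_space \<rho>)"
    using assms(3) by (simp_all add: uniformly_bounded_weight_module_def)
  obtain M where M: "\<And>\<nu>. \<nu> \<in> dual_space cartan \<Longrightarrow>
      (\<exists>S. finite S \<and> weight_space \<rho> \<nu> \<subseteq> complex_vector.span S) \<and>
      complex_vector.dim (weight_space \<rho> \<nu>) \<le> M"
    using assms(3) unfolding uniformly_bounded_weight_module_def by blast
  have bil: "cbilinear \<rho>" and bracket: "\<rho> (lie_bracket x y) v = \<rho> x (\<rho> y v) - \<rho> y (\<rho> x v)" for x y v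
    using mod by (simp_all add: lie_module_def)
  have lin: "clinear (\<rho> x)" for x using bil by (simp add: cbilinear_def)
  have lin': "\<rho> (x + y) v = \<rho> x v + \<rho> y v" "\<rho> (c *\<^sub>C x) v = c *\<^sub>C \<rho> x v" for x y c v
    using bil by (simp_all add: cbilinear_def Vector_Spaces.linear_iff)
  define E where "E x = Endo (\<rho> x)" for x
  have app_E [simp]: "app (E x) = \<rho> x" for x
    using lin by (simp add: E_def Endo_inverse)
  have E_lin: "E (x + y) = E x + E y" "E (c *\<^sub>C x) = c *\<^sub>C E x" for x y c
    by (auto intro: endo_eqI simp: lin')
  have E_br: "br (E x) (E y) = E (lie_bracket x y)" for x y
    by (rule endo_eqI) (simp add: br_def bracket)
  define T where "T m b = E (SA_t m \<otimes>\<^sub>C b)" for m :: "int ^ 'n" and b :: 'b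
  define D where "D u r b = E (SA_D u r \<otimes>\<^sub>C b)" for u :: "complex ^ 'n" and r and b :: 'b
  define Lam where "Lam = (\<lambda>\<nu> u. \<nu> (SA_D u 0 :: 'n SA) :: complex) ` dual_space cartan"
  have wt: "{v. \<forall>u. app (D u 0 1) v = \<nu> (SA_D u 0) *\<^sub>C v} = weight_space \<rho> \<nu>" for \<nu>
    by (auto simp: weight_space_def cartan_eq D_def)
  interpret SA_operators T D Lam M
  proof
    show "CARD('n) \<ge> 2" by (rule assms(1))
    fix m r s :: "int ^ 'n" and u v :: "complex ^ 'n" and b c :: 'b and k :: complex
    show "T m (b + c) = T m b + T m c" "T m (k *\<^sub>C b) = k *\<^sub>C T m b"
      "D u r (b + c) = D u r b + D u r c" "D u r (k *\<^sub>C b) = k *\<^sub>C D u r b"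
      by (simp_all add: T_def D_def tensor_of_add_right tensor_of_scale_right E_lin)
    have "br (T r b) (T s c) = E (0 \<otimes>\<^sub>C (b * c))"
      by (simp add: T_def E_br lie_bracket_tensor_of lie_bracket_t_t)
    also have "\<dots> = 0" using E_lin(2)[of 0 0] by (simp add: tensor_of_0_left)
    finally show "T r b * T s c = T s c * T r b" by (simp add: br_eq_0_iff)
    show "\<exists>v :: 'v. v \<noteq> 0" using assms(4) by (auto simp: irreducible_module_def)
    show "\<exists>s b. s \<noteq> 0 \<and> T s b \<noteq> 0"
    proof -
      obtain s v where s: "s \<noteq> 0" "\<rho> (SA_t s \<otimes>\<^sub>C 1) v \<noteq> 0" using assms(6) by blast
      then have "T s 1 \<noteq> 0" by (metis T_def app_E app_simps(1))
      then show ?thesis using s(1) by blast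
    qed
    assume u: "pairing u r = 0"
    show "D (k *\<^sub>C u) r b = k *\<^sub>C D u r b"
      by (simp add: D_def SA_D_scale[OF u] tensor_of_scale_left E_lin)
    show "br (D u r b) (T s c) = pairing u s *\<^sub>C T (r + s) (b * c)"
      by (simp add: D_def T_def E_br lie_bracket_tensor_of lie_bracket_D_t[OF u] tensor_of_scale_left E_lin)
    assume v: "pairing v s = 0"
    show "br (D u r b) (D v s c) = D (pairing u s *\<^sub>C v - pairing v r *\<^sub>C u) (r + s) (b * c)"
      by (simp add: D_def E_br lie_bracket_tensor_of lie_bracket_D_D[OF u v])
  next
    fix U :: "'v set"
    assume "complex_vector.subspace U"
      and "\<And>u r b v. pairing u r = 0 \<Longrightarrow> v \<in> U \<Longrightarrow> app (D u r b) v \<in> U"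
      and "\<And>r b v. v \<in> U \<Longrightarrow> app (T r b) v \<in> U"
    then have "lie_submodule \<rho> U" by (intro stable_of_generators[OF bil]) (simp_all add: D_def T_def)
    then show "U = {0} \<or> U = UNIV" using assms(4) by (simp add: irreducible_module_def)
  next
    fix \<nu> assume "\<nu> \<in> Lam"
    then obtain \<nu>' where \<nu>': "\<nu>' \<in> dual_space cartan" "\<nu> = (\<lambda>u. \<nu>' (SA_D u 0))" by (auto simp: Lam_def)
    then show "dim_bound {v. \<forall>u. app (D u 0 1) v = \<nu> u *\<^sub>C v} M"
      using M[OF \<nu>'(1)] by (auto simp: wt intro: dim_boundI)
  next
    have "v \<in> complex_vector.span (\<Union>\<nu>\<in>dual_space cartan. weight_space \<rho> \<nu>)" for v
    proof -
      obtain f where f: "\<forall>i\<in>dual_space cartan. f i \<in> weight_space \<rho> i"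
        "{i. f i \<noteq> 0} \<subseteq> dual_space cartan" "v = (\<Sum>i | f i \<noteq> 0. f i)"
        using dec unfolding direct_sum_decomp_def by blast
      show ?thesis
        unfolding f(3) using f(1,2) by (intro complex_vector.span_sum complex_vector.span_base) blast
    qed
    then show "complex_vector.span (\<Union>\<nu>\<in>Lam. {v. \<forall>u. app (D u 0 1) v = \<nu> u *\<^sub>C v}) = UNIV"
      by (auto simp: Lam_def wt)
  qed
  show ?thesis
  proof (intro allI)
    fix u b
    obtain c where c: "D u 0 b = c *\<^sub>C 1 + chi b *\<^sub>C D u 0 1" using D_0_eq by blast
    have "\<rho> (SA_D u 0 \<otimes>\<^sub>C b) v = (c + chi b * (\<Sum>i\<in>UNIV. u $ i * \<Lambda> $ i)) *\<^sub>C v"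
      if v: "v \<in> weight_space_coord \<rho> \<Lambda>" for v
    proof -
      have lin1: "clinear (\<lambda>x. \<rho> (x \<otimes>\<^sub>C 1) v)"
        by (rule clinearI) (simp_all add: tensor_of_add_left tensor_of_scale_left lin')
      have "\<rho> (SA_D u 0 \<otimes>\<^sub>C 1) v = (\<Sum>i\<in>UNIV. u $ i *\<^sub>C \<rho> (SA_d i \<otimes>\<^sub>C 1) v)"
        unfolding SA_D_0_eq_sum by (simp only: clinear_sum[OF lin1] clinear_scale[OF lin1])
      also have "\<dots> = (\<Sum>i\<in>UNIV. u $ i * \<Lambda> $ i) *\<^sub>C v"
        using v by (simp add: weight_space_coord_def complex_vector.scale_sum_left)
      finally have D1: "app (D u 0 1) v = (\<Sum>i\<in>UNIV. u $ i * \<Lambda> $ i) *\<^sub>C v" by (simp add: D_def)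
      have "\<rho> (SA_D u 0 \<otimes>\<^sub>C b) v = app (D u 0 b) v" by (simp add: D_def)
      also have "\<dots> = (c + chi b * (\<Sum>i\<in>UNIV. u $ i * \<Lambda> $ i)) *\<^sub>C v"
        unfolding c by (simp add: D1 scaleC_add_left)
      finally show ?thesis .
    qed
    then show "\<exists>c. \<forall>v\<in>weight_space_coord \<rho> \<Lambda>. \<rho> (SA_D u 0 \<otimes>\<^sub>C b) v = c *\<^sub>C v" by blast
  qed
qed

end
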